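(* Let $X=\{1,\dots,k\}^{\mathbb N}$ with the shift $T$, let $\mu$ be the Gibbs state of a Hölder normalized potential $\log p$, let $H>0$ be Hölder and $\beta\in\mathbb R$. If $\psi$ is any KMS state on $\mathcal U(\mu)$ for $H$ at inverse temperature $\beta$, then $\psi=\psi_\beta$, where $\psi_\beta$ is the state with $$\psi_\beta(M_fe_nM_g)=\int f\,\lambda^{-[n]}\,g\,d\nu_\beta\qquad(f,g\in C(X),\ n\ge0),$$ and $\nu_\beta$ is the eigenprobability of $\mathcal L_{-\beta\log H}^*$.
   Context: $X=\{1,\dots,k\}^{\mathbb N}$, $T$ the left shift, $C(X)$ the complex continuous functions. $p>0$ Hölder with $\sum_{T(z)=x}p(z)=1$; $\mathcal L_pf(x)=\sum_{T(z)=x}p(z)f(z)$ and $\mu$ is the probability with $\int\mathcal L_pf\,d\mu=\int f\,d\mu$. For real continuous $A$, $\mathcal L_Af(x)=\sum_{T(z)=x}e^{A(z)}f(z)$, with dual $\int f\,d(\mathcal L_A^*\nu)=\int\mathcal L_Af\,d\nu$; $\nu_\beta$ is the unique probability with $\mathcal L_{-\beta\log H}^*\nu_\beta=\lambda_\beta\nu_\beta$, $\lambda_\beta$ the largest eigenvalue of $\mathcal L_{-\beta\log H}$. $\lambda^{-[n]}(x)=\prod_{j=0}^{n-1}p(T^jx)$. On $L^2(\mu)$: $S\eta=\eta\circ T$, $S^*=\mathcal L_p$ its adjoint, $M_f\eta=f\eta$, $e_n=S^n(S^* )^n$. $\mathcal U(\mu)$ is the C*-algebra of bounded operators on $L^2(\mu)$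 generated by the $M_fS^n(S^* )^nM_g$ ($n\ge0$, $f,g\in C(X)$). The automorphism group $\sigma_t$ is determined by $\sigma_t(M_f)=M_f$, $\sigma_t(S)=M_{H^{it}}S$; $a$ is analytic if $t\mapsto\sigma_t(a)$ extends to an entire function. A state $\psi$ (positive linear functional with $\psi(1)=1$) is KMS for $H$ at $\beta$ if $\psi(ab)=\psi(b\,\sigma_{i\beta}(a))$ for all $b\in\mathcal U$ and analytic $a\in\mathcal U$. *)

theory Defs
  imports "HOL-Probability.Probability"
begin

type_synonym pt = "nat \<Rightarrow> nat"
type_synonym vec = "pt \<Rightarrow> complex"
type_synonym op = "vec \<Rightarrow> vec"

definition Xs :: "nat \<Rightarrow> pt set" where
  "Xs k = {x. \<forall>n. x n \<in> {1..k}}"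

definition shift :: "pt \<Rightarrow> pt" where
  "shift x = (\<lambda>n. x (Suc n))"

text \<open>Standard metric on the shift space; it induces the product topology.\<close>
definition dX :: "pt \<Rightarrow> pt \<Rightarrow> real" where
  "dX x y = (if x = y then 0 else (1/2) ^ (LEAST n. x n \<noteq> y n))"

definition contX :: "nat \<Rightarrow> (pt \<Rightarrow> 'a::metric_space) \<Rightarrow> bool" where
  "contX k f \<longleftrightarrow> (\<forall>x\<in>Xs k. \<forall>e>0. \<exists>d>0. \<forall>y\<in>Xs k. dX x y < d \<longrightarrow> dist (f y) (f x) < e)"

definition holderX :: "nat \<Rightarrow> (pt \<Rightarrow> real) \<Rightarrow> bool" where
  "holderX k f \<longleftrightarrow> (\<exists>C \<alpha>. \<alpha> > 0 \<and>
     (\<forall>x\<in>Xs k. \<forall>y\<in>Xs k. \<bar>f x - f y\<bar> \<le> C * dX x y powr \<alpha>))"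

definition cylinders :: "nat \<Rightarrow> pt set set" where
  "cylinders k = {{x\<in>Xs k. \<forall>i<n. x i = w i} | n w. True}"

definition borelX :: "nat \<Rightarrow> pt measure" where
  "borelX k = sigma (Xs k) (cylinders k)"

text \<open>Transfer operator with weight w: (LL w f)(x) = sum over T z = x of w z f z.
  L_p is LL k p, and L_A is LL k (exp o A).\<close>
definition LL :: "nat \<Rightarrow> (pt \<Rightarrow> real) \<Rightarrow> (pt \<Rightarrow> 'a::real_vector) \<Rightarrow> pt \<Rightarrow> 'a" where
  "LL k w f x = (\<Sum>z\<in>{z\<in>Xs k. shift z = x}. w z *\<^sub>R f z)"

definition is_eigenvalue :: "nat \<Rightarrow> (pt \<Rightarrow> real) \<Rightarrow> complex \<Rightarrow> bool" where
  "is_eigenvalue k w c \<longleftrightarrow> (\<exists>f::pt \<Rightarrow> complex. contX k f \<and> (\<exists>x\<in>Xs k. f x \<noteq> 0) \<and>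
      (\<forall>x\<in>Xs k. LL k w f x = c * f x))"

definition largest_eigenvalue :: "nat \<Rightarrow> (pt \<Rightarrow> real) \<Rightarrow> real \<Rightarrow> bool" where
  "largest_eigenvalue k w l \<longleftrightarrow> is_eigenvalue k w (complex_of_real l) \<and>
      (\<forall>c. is_eigenvalue k w c \<longrightarrow> cmod c \<le> l)"

definition lam_inv :: "(pt \<Rightarrow> real) \<Rightarrow> nat \<Rightarrow> pt \<Rightarrow> real" where
  "lam_inv p n x = (\<Prod>j<n. p ((shift ^^ j) x))"

definition L2 :: "pt measure \<Rightarrow> vec set" where
  "L2 \<mu> = {\<xi>. \<xi> \<in> borel_measurable \<mu> \<and> integrable \<mu> (\<lambda>x. (cmod (\<xi> x))\<^sup>2)}"

definition l2norm :: "pt measure \<Rightarrow> vec \<Rightarrow> real" where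
  "l2norm \<mu> \<xi> = sqrt (\<integral>x. (cmod (\<xi> x))\<^sup>2 \<partial>\<mu>)"

definition inner2 :: "pt measure \<Rightarrow> vec \<Rightarrow> vec \<Rightarrow> complex" where
  "inner2 \<mu> \<xi> \<eta> = (\<integral>x. \<xi> x * cnj (\<eta> x) \<partial>\<mu>)"

definition op_eq :: "pt measure \<Rightarrow> op \<Rightarrow> op \<Rightarrow> bool" where
  "op_eq \<mu> A B \<longleftrightarrow> (\<forall>\<xi>\<in>L2 \<mu>. AE x in \<mu>. A \<xi> x = B \<xi> x)"

definition bounded_op :: "pt measure \<Rightarrow> op \<Rightarrow> bool" where
  "bounded_op \<mu> A \<longleftrightarrow>
     (\<forall>\<xi>\<in>L2 \<mu>. A \<xi> \<in> L2 \<mu>) \<and>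
     (\<forall>\<xi>\<in>L2 \<mu>. \<forall>\<eta>\<in>L2 \<mu>. (AE x in \<mu>. \<xi> x = \<eta> x) \<longrightarrow> (AE x in \<mu>. A \<xi> x = A \<eta> x)) \<and>
     (\<forall>\<xi>\<in>L2 \<mu>. \<forall>\<eta>\<in>L2 \<mu>. \<forall>c. AE x in \<mu>. A (\<lambda>y. \<xi> y + c * \<eta> y) x = A \<xi> x + c * A \<eta> x) \<and>
     (\<exists>C. \<forall>\<xi>\<in>L2 \<mu>. l2norm \<mu> (A \<xi>) \<le> C * l2norm \<mu> \<xi>)"

definition opnorm :: "pt measure \<Rightarrow> op \<Rightarrow> real" where
  "opnorm \<mu> A = Sup {l2norm \<mu> (A \<xi>) | \<xi>. \<xi> \<in> L2 \<mu> \<and> l2norm \<mu> \<xi> \<le> 1}"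

definition op_add :: "op \<Rightarrow> op \<Rightarrow> op" where
  "op_add A B = (\<lambda>\<xi> x. A \<xi> x + B \<xi> x)"

definition op_minus :: "op \<Rightarrow> op \<Rightarrow> op" where
  "op_minus A B = (\<lambda>\<xi> x. A \<xi> x - B \<xi> x)"

definition op_scale :: "complex \<Rightarrow> op \<Rightarrow> op" where
  "op_scale c A = (\<lambda>\<xi> x. c * A \<xi> x)"

definition is_adjoint :: "pt measure \<Rightarrow> op \<Rightarrow> op \<Rightarrow> bool" where
  "is_adjoint \<mu> A B \<longleftrightarrow> (\<forall>\<xi>\<in>L2 \<mu>. \<forall>\<eta>\<in>L2 \<mu>. inner2 \<mu> (A \<xi>) \<eta> = inner2 \<mu> \<xi> (B \<eta>))"

definition Mop :: "(pt \<Rightarrow> complex) \<Rightarrow> op" where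
  "Mop f = (\<lambda>\<xi> x. f x * \<xi> x)"

definition Sop :: op where
  "Sop = (\<lambda>\<xi>. \<xi> \<circ> shift)"

definition Sadj :: "nat \<Rightarrow> (pt \<Rightarrow> real) \<Rightarrow> op" where
  "Sadj k p = LL k p"

definition eop :: "nat \<Rightarrow> (pt \<Rightarrow> real) \<Rightarrow> nat \<Rightarrow> op" where
  "eop k p n = (Sop ^^ n) \<circ> (Sadj k p ^^ n)"

definition genop :: "nat \<Rightarrow> (pt \<Rightarrow> real) \<Rightarrow> (pt \<Rightarrow> complex) \<Rightarrow> nat \<Rightarrow> (pt \<Rightarrow> complex) \<Rightarrow> op" where
  "genop k p f n g = Mop f \<circ> eop k p n \<circ> Mop g"

inductive_set Ualg :: "nat \<Rightarrow> (pt \<Rightarrow> real) \<Rightarrow> pt measure \<Rightarrow> op set"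
  for k p \<mu> where
  gen: "contX k f \<Longrightarrow> contX k g \<Longrightarrow> genop k p f n g \<in> Ualg k p \<mu>"
| add: "A \<in> Ualg k p \<mu> \<Longrightarrow> B \<in> Ualg k p \<mu> \<Longrightarrow> op_add A B \<in> Ualg k p \<mu>"
| scale: "A \<in> Ualg k p \<mu> \<Longrightarrow> op_scale c A \<in> Ualg k p \<mu>"
| comp: "A \<in> Ualg k p \<mu> \<Longrightarrow> B \<in> Ualg k p \<mu> \<Longrightarrow> A \<circ> B \<in> Ualg k p \<mu>"
| adj: "A \<in> Ualg k p \<mu> \<Longrightarrow> bounded_op \<mu> B \<Longrightarrow> is_adjoint \<mu> A B \<Longrightarrow> B \<in> Ualg k p \<mu>"
| lim: "(\<And>m. As m \<in> Ualg k p \<mu>) \<Longrightarrow> bounded_op \<mu> B \<Longrightarrow>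
        (\<lambda>m. opnorm \<mu> (op_minus (As m) B)) \<longlonglongrightarrow> 0 \<Longrightarrow> B \<in> Ualg k p \<mu>"

definition is_state :: "pt measure \<Rightarrow> op set \<Rightarrow> (op \<Rightarrow> complex) \<Rightarrow> bool" where
  "is_state \<mu> U \<psi> \<longleftrightarrow>
     (\<forall>a\<in>U. \<forall>b\<in>U. \<psi> (op_add a b) = \<psi> a + \<psi> b) \<and>
     (\<forall>a\<in>U. \<forall>c. \<psi> (op_scale c a) = c * \<psi> a) \<and>
     (\<forall>a\<in>U. \<forall>b\<in>U. op_eq \<mu> a b \<longrightarrow> \<psi> a = \<psi> b) \<and>
     (\<forall>a\<in>U. \<forall>b. bounded_op \<mu> b \<and> is_adjoint \<mu> a b \<longrightarrow> Im (\<psi> (b \<circ> a)) = 0 \<and> Re (\<psi> (b \<circ> a)) \<ge> 0) \<and>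
     \<psi> id = 1"

definition star_hom :: "pt measure \<Rightarrow> op set \<Rightarrow> (op \<Rightarrow> op) \<Rightarrow> bool" where
  "star_hom \<mu> U \<phi> \<longleftrightarrow>
     (\<forall>a\<in>U. \<phi> a \<in> U) \<and>
     (\<forall>a\<in>U. \<forall>b\<in>U. op_eq \<mu> a b \<longrightarrow> op_eq \<mu> (\<phi> a) (\<phi> b)) \<and>
     (\<forall>a\<in>U. \<forall>b\<in>U. op_eq \<mu> (\<phi> (op_add a b)) (op_add (\<phi> a) (\<phi> b))) \<and>
     (\<forall>a\<in>U. \<forall>c. op_eq \<mu> (\<phi> (op_scale c a)) (op_scale c (\<phi> a))) \<and>
     (\<forall>a\<in>U. \<forall>b\<in>U. op_eq \<mu> (\<phi> (a \<circ> b)) (\<phi> a \<circ> \<phi> b)) \<and>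
     (\<forall>a\<in>U. \<forall>b\<in>U. is_adjoint \<mu> a b \<longrightarrow> is_adjoint \<mu> (\<phi> a) (\<phi> b))"

definition entire_ext :: "pt measure \<Rightarrow> (real \<Rightarrow> op \<Rightarrow> op) \<Rightarrow> op \<Rightarrow> (complex \<Rightarrow> op) \<Rightarrow> bool" where
  "entire_ext \<mu> \<sigma> a F \<longleftrightarrow>
     (\<forall>z. bounded_op \<mu> (F z)) \<and>
     (\<forall>t. op_eq \<mu> (F (complex_of_real t)) (\<sigma> t a)) \<and>
     (\<forall>z. \<exists>D. bounded_op \<mu> D \<and>
        ((\<lambda>h. opnorm \<mu> (op_minus (op_scale (1 / h) (op_minus (F (z + h)) (F z))) D)) \<longlongrightarrow> 0) (at 0))"

definition is_KMS :: "pt measure \<Rightarrow> op set \<Rightarrow> (real \<Rightarrow> op \<Rightarrow> op) \<Rightarrow> real \<Rightarrow> (op \<Rightarrow> complex) \<Rightarrow> bool" where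
  "is_KMS \<mu> U \<sigma> \<beta> \<psi> \<longleftrightarrow> is_state \<mu> U \<psi> \<and>
     (\<forall>a\<in>U. \<forall>b\<in>U. \<forall>F. entire_ext \<mu> \<sigma> a F \<longrightarrow>
        \<psi> (a \<circ> b) = \<psi> (b \<circ> F (\<i> * complex_of_real \<beta>)))"

end

theory Submission
  imports Defs
begin

text \<open>
  Let \<open>\<rho>(f) = \<psi>(M\<^sub>f)\<close>. The KMS condition with \<open>a = M\<^sub>f\<close> gives
  \<open>\<psi>(M\<^sub>f e\<^sub>n M\<^sub>g) = \<psi>(e\<^sub>n M\<^bsub>gf\<^esub>)\<close>, and a quasi-basis of cylinder indicators turns this into
  \<open>\<rho>(f g \<lambda>\<^bsup>-[n]\<^esup>)\<close>; it remains to see that \<open>\<rho> = \<integral> \<cdot> d\<nu>\<^sub>\<beta>\<close>.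
  Since \<open>e\<^sub>n\<close> is an averaging operator with a bounded kernel, \<open>\<sigma>\<^sub>t(e\<^sub>n)\<close> extends to an entire function, and
  the KMS condition with \<open>a = e\<^sub>n\<close>, \<open>b = e\<^sub>n M\<^sub>g\<close> yields
  \<open>\<rho>(f) = \<rho>(R\<^sub>n \<cdot> (L\<^sup>n f) \<circ> T\<^sup>n)\<close> with a positive function \<open>R\<^sub>n\<close> and \<open>L = \<L>\<^bsub>-\<beta> log H\<^esub>\<close>.
  Hence \<open>a L\<^sup>n 1 \<le> L\<^sup>n f \<le> b L\<^sup>n 1\<close> implies \<open>a \<le> \<rho>(f) \<le> b\<close>, and likewise for \<open>\<nu>\<^sub>\<beta>\<close>.
  By bounded distortion, the oscillation of \<open>L\<^sup>n f / L\<^sup>n 1\<close> tends to 0, so the two integrals agree.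
\<close>

section \<open>The shift space\<close>

text \<open>The identity for \<open>e_n\<close> rests on three facts: \<open>e_n\<close> is
  idempotent; its flow continues at i beta to H^(-beta[n]) e_n H^(beta[n]), where H^[n] is the
  product of H along the orbit; and e_n M_h e_n = M_E(h) e_n, where E(h) averages h over the fibre
  of T^n with weights lambda^(-[n]). Taking g = f / lambda^(-[n]) cancels these weights, and what
  remains of the average is L^n f composed with T^n.

  The factor R_n is positive but not constant, so rho is not seen to be an eigenfunctional of L.
  What the identity does give is that rho(h) >= 0 as soon as L^n h >= 0. Applied to f - a and b - f,
  this yields the sandwich through which rho is compared with nu.

  Two obstacles shape the preparation. Invariance of mu is given against continuous functions, while
  boundedness on L^2 needs it for measurable ones. And analyticity is asked in operator norm, so
  difference quotients of the flow need estimates on their kernels.\<close>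

lemma Xs_eq_PiE: "Xs k = Pi\<^sub>E UNIV (\<lambda>_. {1..k})"
  by (auto simp: Xs_def PiE_def Pi_def)

lemma compact_Xs: "compact (Xs k)"
proof -
  have "compactin (product_topology (\<lambda>_. euclidean) UNIV) (Pi\<^sub>E UNIV (\<lambda>_::nat. {1..k}))"
    by (simp add: compactin_PiE finite_imp_compact)
  then show ?thesis
    by (simp add: Xs_eq_PiE euclidean_product_topology)
qed

text \<open>A basic open set of the product topology constrains finitely many coordinates;
  \<open>n\<close> bounds all of them.\<close>

lemma open_contains_cylinder:
  fixes x :: pt
  assumes "open A" "x \<in> A"
  obtains n where "{y. \<forall>i<n. y i = x i} \<subseteq> A"
proof -
  obtain X where X: "x \<in> Pi\<^sub>E UNIV X" "finite {i. X i \<noteq> topspace euclidean}" "Pi\<^sub>E UNIV X \<subseteq> A"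
    using product_topology_open_contains_basis[of "\<lambda>_. euclidean" UNIV A x] assms
    by (auto simp: open_fun_def)
  obtain n where n: "\<forall>i\<in>{i. X i \<noteq> UNIV}. i < n"
    using X(2) by (metis finite_nat_set_iff_bounded topspace_euclidean)
  have "{y. \<forall>i<n. y i = x i} \<subseteq> Pi\<^sub>E UNIV X"
    using X(1) n by (fastforce simp: PiE_iff)
  then show ?thesis
    using X(3) by (intro that) (rule order_trans)
qed

lemma open_cylinder: "open {y::pt. \<forall>i<n. y i = x i}"
proof -
  have "{y::pt. \<forall>i<n. y i = x i} = (\<Inter>i\<in>{..<n}. (\<lambda>y. y i) -` {x i})"
    by auto
  then show ?thesis
    by (auto intro!: open_INT open_vimage Topological_Spaces.open_discrete)
qed

lemma dX_le:
  assumes "\<forall>i<n. x i = y i"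
  shows "dX x y \<le> (1/2) ^ n"
proof (cases "x = y")
  case False
  then have "\<exists>i. x i \<noteq> y i" by auto
  then have "x (LEAST i. x i \<noteq> y i) \<noteq> y (LEAST i. x i \<noteq> y i)"
    by (rule LeastI_ex)
  then have "n \<le> (LEAST i. x i \<noteq> y i)"
    using assms not_less by blast
  with False show ?thesis
    by (simp add: dX_def power_decreasing)
qed (simp add: dX_def)

text \<open>Agreement includes coordinate \<open>n\<close> itself: strict inequality pushes the
  first disagreement beyond \<open>n\<close>.\<close>

lemma dX_less_agree:
  assumes "dX x y < (1/2) ^ n" "i \<le> n"
  shows "x i = y i"
proof (rule ccontr)
  assume neq: "x i \<noteq> y i"
  then have "(LEAST j. x j \<noteq> y j) \<le> n"
    using assms(2) by (meson Least_le order_trans)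
  then have "(1/2::real) ^ n \<le> dX x y"
    using neq by (auto simp: dX_def intro!: power_decreasing)
  with assms(1) show False by simp
qed

text \<open>Metric balls and product-open sets both reduce to cylinders around a point. Afterwards
  only the product topology on \<open>pt\<close> is used, so the general theory of continuity and
  compactness applies.\<close>

lemma contX_iff_continuous_on: "contX k f \<longleftrightarrow> continuous_on (Xs k) f"
proof
  assume f: "contX k f"
  show "continuous_on (Xs k) f"
    unfolding continuous_on_topological
  proof (intro ballI allI impI)
    fix x B assume x: "x \<in> Xs k" and B: "open B" "f x \<in> B"
    then obtain e where e: "e > 0" "ball (f x) e \<subseteq> B"
      by (meson open_contains_ball)
    obtain d where d: "d > 0" "\<forall>y\<in>Xs k. dX x y < d \<longrightarrow> dist (f y) (f x) < e"
      using f x e(1) unfolding contX_def by blast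
    obtain n where n: "(1/2::real) ^ n < d"
      using real_arch_pow_inv[OF d(1), of "1/2"] by auto
    show "\<exists>A. open A \<and> x \<in> A \<and> (\<forall>y\<in>Xs k. y \<in> A \<longrightarrow> f y \<in> B)"
    proof (intro exI[of _ "{y. \<forall>i<n. y i = x i}"] conjI ballI impI open_cylinder)
      fix y assume "y \<in> Xs k" "y \<in> {y. \<forall>i<n. y i = x i}"
      then have "dist (f y) (f x) < e"
        using dX_le[of n x y] d(2) n by fastforce
      then show "f y \<in> B" using e(2) by (auto simp: dist_commute)
    qed simp
  qed
next
  assume f: "continuous_on (Xs k) f"
  show "contX k f"
    unfolding contX_def
  proof (intro ballI allI impI)
    fix x and e :: real assume x: "x \<in> Xs k" and e: "e > 0"
    obtain A where A: "open A" "x \<in> A" "\<forall>y\<in>Xs k. y \<in> A \<longrightarrow> f y \<in> ball (f x) e"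
      using f x e unfolding continuous_on_topological by (meson centre_in_ball open_ball)
    obtain n where n: "{y. \<forall>i<n. y i = x i} \<subseteq> A"
      using open_contains_cylinder[OF A(1,2)] .
    have "dist (f y) (f x) < e" if "y \<in> Xs k" "dX x y < (1/2) ^ n" for y
    proof -
      have "y \<in> A" using n dX_less_agree[OF that(2)] by fastforce
      then show ?thesis using A(3) that(1) by (auto simp: dist_commute)
    qed
    then show "\<exists>d>0. \<forall>y\<in>Xs k. dX x y < d \<longrightarrow> dist (f y) (f x) < e"
      by (intro exI[of _ "(1/2) ^ n"]) auto
  qed
qed

text \<open>Heine-Cantor with cylinders: finitely many cylinders on which \<open>f\<close> moves by
  less than \<open>e/2\<close> cover the space, and the longest of their lengths serves
  everywhere.\<close>

lemma continuous_on_Xs_uniform: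
  fixes f :: "pt \<Rightarrow> 'a::metric_space"
  assumes "continuous_on (Xs k) f" "e > 0"
  obtains n where "\<And>x y. x \<in> Xs k \<Longrightarrow> y \<in> Xs k \<Longrightarrow> (\<forall>i<n. x i = y i) \<Longrightarrow> dist (f x) (f y) < e"
proof -
  have "\<exists>n. \<forall>y\<in>Xs k. (\<forall>i<n. y i = x i) \<longrightarrow> dist (f x) (f y) < e/2" if x: "x \<in> Xs k" for x
  proof -
    obtain A where A: "open A" "x \<in> A" "\<forall>y\<in>Xs k. y \<in> A \<longrightarrow> f y \<in> ball (f x) (e/2)"
      using assms x unfolding continuous_on_topological
      by (meson centre_in_ball half_gt_zero open_ball)
    obtain n where "{y. \<forall>i<n. y i = x i} \<subseteq> A"
      using open_contains_cylinder[OF A(1,2)] .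
    with A(3) show ?thesis by (intro exI[of _ n]) auto
  qed
  then obtain N where N: "\<And>x y. x \<in> Xs k \<Longrightarrow> y \<in> Xs k \<Longrightarrow> \<forall>i<N x. y i = x i \<Longrightarrow> dist (f x) (f y) < e/2"
    by metis
  obtain D where D: "D \<subseteq> Xs k" "finite D" "Xs k \<subseteq> (\<Union>x\<in>D. {y. \<forall>i<N x. y i = x i})"
  proof (rule compactE_image[OF compact_Xs[of k], of "Xs k" "\<lambda>x. {y. \<forall>i<N x. y i = x i}"])
    show "Xs k \<subseteq> (\<Union>c\<in>Xs k. {y. \<forall>i<N c. y i = c i})" by auto
  qed (auto intro: open_cylinder)
  define n where "n = Max (insert 0 (N ` D))"
  have Nn: "N c \<le> n" if "c \<in> D" for c
    using that D(2) by (auto simp: n_def intro!: Max_ge)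
  show ?thesis
  proof (rule that[of n])
    fix x y assume xy: "x \<in> Xs k" "y \<in> Xs k" "\<forall>i<n. x i = y i"
    then obtain c where c: "c \<in> D" "\<forall>i<N c. x i = c i" using D(3) by blast
    moreover have "\<forall>i<N c. y i = c i"
      using c xy(3) Nn[OF c(1)] by (metis less_le_trans)
    ultimately have "dist (f c) (f x) < e/2" "dist (f c) (f y) < e/2"
      using N D(1) xy by blast+
    then show "dist (f x) (f y) < e"
      by (metis dist_commute dist_triangle_half_r)
  qed
qed

section \<open>Words, inverse branches and iterated transfer operators\<close>

definition words :: "nat \<Rightarrow> nat \<Rightarrow> pt set" where
  "words k n = Pi\<^sub>E {..<n} (\<lambda>_. {1..k})"

text \<open>For fixed \<open>v\<close> this is the inverse branch of the \<open>n\<close>-th power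
  of the shift with prefix \<open>v\<close>. Words are extensional functions, so
  \<open>restrict x {..<n}\<close> is the unique word of the cylinder containing \<open>x\<close>,
  and sums over a fibre become sums over the fixed finite set \<open>words k n\<close>.\<close>

definition cat :: "nat \<Rightarrow> pt \<Rightarrow> pt \<Rightarrow> pt" where
  "cat n v x = (\<lambda>i. if i < n then v i else x (i - n))"

lemma finite_words [simp]: "finite (words k n)"
  by (simp add: words_def finite_PiE)

lemma shift_funpow: "(shift ^^ n) x = (\<lambda>i. x (i + n))"
  by (induction n arbitrary: x) (auto simp: shift_def)

lemma shift_in_Xs: "x \<in> Xs k \<Longrightarrow> (shift ^^ n) x \<in> Xs k"
  by (simp add: shift_funpow Xs_def)

lemma cat_in_Xs: "v \<in> words k n \<Longrightarrow> x \<in> Xs k \<Longrightarrow> cat n v x \<in> Xs k"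
  by (auto simp: words_def cat_def Xs_def PiE_iff)

lemma shift_cat [simp]: "(shift ^^ n) (cat n v x) = x"
  by (simp add: shift_funpow cat_def)

lemma cat_restrict_shift [simp]: "cat n (restrict x {..<n}) ((shift ^^ n) x) = x"
  by (auto simp: cat_def shift_funpow)

lemma restrict_in_words: "x \<in> Xs k \<Longrightarrow> restrict x {..<n} \<in> words k n"
  by (auto simp: words_def Xs_def)

lemma restrict_cat [simp]: "v \<in> words k n \<Longrightarrow> restrict (cat n v x) {..<n} = v"
  by (auto simp: words_def cat_def PiE_def extensional_def)

lemma preimage_shift:
  assumes "x \<in> Xs k"
  shows "{z\<in>Xs k. (shift ^^ n) z = x} = (\<lambda>v. cat n v x) ` words k n"
proof (intro equalityI subsetI)
  fix z assume "z \<in> {z\<in>Xs k. (shift ^^ n) z = x}"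
  then show "z \<in> (\<lambda>v. cat n v x) ` words k n"
    by (intro image_eqI[of _ _ "restrict z {..<n}"]) (auto simp: restrict_in_words)
qed (use assms in \<open>auto simp: cat_in_Xs\<close>)

lemma inj_on_cat: "inj_on (\<lambda>v. cat n v x) (words k n)"
  by (rule inj_on_inverseI[where g = "\<lambda>z. restrict z {..<n}"]) simp

lemma finite_preimage_shift: "finite {z\<in>Xs k. (shift ^^ n) z = x}"
proof (cases "x \<in> Xs k")
  case False
  then have "{z\<in>Xs k. (shift ^^ n) z = x} = {}" by (auto simp: shift_in_Xs)
  then show ?thesis by (simp only: finite.emptyI)
qed (simp add: preimage_shift)

lemma sum_preimage_shift:
  assumes "x \<in> Xs k"
  shows "(\<Sum>z\<in>{z\<in>Xs k. (shift ^^ n) z = x}. g z) = (\<Sum>v\<in>words k n. g (cat n v x))"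
  by (simp add: preimage_shift[OF assms] sum.reindex[OF inj_on_cat])

lemma lam_inv_0 [simp]: "lam_inv w 0 x = 1"
  by (simp add: lam_inv_def)

lemma lam_inv_add: "lam_inv w (m + n) x = lam_inv w m x * lam_inv w n ((shift ^^ m) x)"
  by (induction n) (simp_all add: lam_inv_def shift_funpow algebra_simps)

text \<open>The preimages \<open>z\<close> of \<open>x\<close> under the power \<open>Suc n\<close>
  are grouped by \<open>y = (shift ^^ n) z\<close>, which runs through the fibre of one shift over
  \<open>x\<close>; the weights multiply along the orbit. All later statements on iterates are read
  off from this finite sum.\<close>

lemma LL_funpow:
  assumes "x \<in> Xs k"
  shows "(LL k w ^^ n) f x = (\<Sum>v\<in>words k n. lam_inv w n (cat n v x) *\<^sub>R f (cat n v x))"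
  using assms
proof (induction n arbitrary: x)
  case 0
  have "words k 0 = {\<lambda>_. undefined}" by (simp add: words_def)
  then show ?case by (simp add: cat_def)
next
  case (Suc n)
  let ?S = "{z \<in> Xs k. shift z = x}"
  have "(LL k w ^^ Suc n) f x
      = (\<Sum>y\<in>?S. w y *\<^sub>R (\<Sum>z\<in>{z\<in>Xs k. (shift ^^ n) z = y}. lam_inv w n z *\<^sub>R f z))"
    by (auto simp: LL_def Suc.IH sum_preimage_shift intro!: sum.cong)
  also have "\<dots> = (\<Sum>y\<in>?S. \<Sum>z\<in>{z\<in>Xs k. (shift ^^ n) z = y}. lam_inv w (Suc n) z *\<^sub>R f z)"
    using lam_inv_add[of w n 1]
    by (auto simp: scaleR_sum_right lam_inv_def mult.commute intro!: sum.cong)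
  also have "\<dots> = (\<Sum>z\<in>(\<Union>y\<in>?S. {z\<in>Xs k. (shift ^^ n) z = y}). lam_inv w (Suc n) z *\<^sub>R f z)"
    using finite_preimage_shift[of k 1 x]
    by (intro sum.UNION_disjoint[symmetric]) (auto intro: finite_preimage_shift)
  also have "(\<Union>y\<in>?S. {z\<in>Xs k. (shift ^^ n) z = y}) = {z\<in>Xs k. (shift ^^ Suc n) z = x}"
    by (auto simp: shift_in_Xs)
  finally show ?case by (simp only: sum_preimage_shift[OF Suc.prems])
qed

section \<open>Continuity, distortion and the ratio limit for transfer operators\<close>

lemma continuous_on_cat: "continuous_on S (cat n v)"
proof (rule continuous_on_coordinatewise_then_product)
  show "continuous_on S (\<lambda>x. cat n v x i)" for i
    by (cases "i < n") (auto simp: cat_def intro: continuous_on_subset[OF continuous_on_product_coordinates])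
qed

lemma continuous_on_shift: "continuous_on S (shift ^^ n)"
  by (rule continuous_on_coordinatewise_then_product)
     (auto simp: shift_funpow intro!: continuous_on_subset[OF continuous_on_product_coordinates])

lemma continuous_on_compose_cat:
  assumes "continuous_on (Xs k) f" "v \<in> words k n"
  shows "continuous_on (Xs k) (\<lambda>x. f (cat n v x))"
  using assms by (intro continuous_on_compose2[OF assms(1) continuous_on_cat]) (auto simp: cat_in_Xs)

lemma continuous_on_compose_shift:
  assumes "continuous_on (Xs k) f"
  shows "continuous_on (Xs k) (\<lambda>x. f ((shift ^^ n) x))"
  using assms by (intro continuous_on_compose2[OF assms(1) continuous_on_shift]) (auto simp: shift_in_Xs)

lemma continuous_on_lam_inv:
  assumes "continuous_on (Xs k) w"
  shows "continuous_on (Xs k) (lam_inv w n)"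
  unfolding lam_inv_def by (intro continuous_intros continuous_on_compose_shift assms)

lemma continuous_on_LL_funpow:
  fixes f :: "pt \<Rightarrow> 'a::real_normed_vector"
  assumes "continuous_on (Xs k) w" "continuous_on (Xs k) f"
  shows "continuous_on (Xs k) ((LL k w ^^ n) f)"
proof -
  have "continuous_on (Xs k) (\<lambda>x. \<Sum>v\<in>words k n. lam_inv w n (cat n v x) *\<^sub>R f (cat n v x))"
    by (intro continuous_intros continuous_on_compose_cat assms continuous_on_lam_inv)
  then show ?thesis
    by (simp add: LL_funpow cong: continuous_on_cong)
qed

text \<open>Cylinders are open and closed. This puts multiplication by their indicators into the
  algebra and lets continuous test functions see the generators of the sigma-algebra.\<close>

lemma continuous_on_word_indicator:
  "continuous_on (Xs k) (\<lambda>x. if restrict x {..<n} = v then 1 else 0 :: 'a::real_normed_algebra_1)"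
proof -
  have "restrict y {..<n} = restrict x {..<n}" if "dX x y < (1/2) ^ n" for x y
    using dX_less_agree[OF that] by (auto simp: restrict_def)
  then show ?thesis
    unfolding contX_iff_continuous_on[symmetric] contX_def
    by (intro ballI allI impI exI[of _ "(1/2) ^ n"]) auto
qed

lemma continuous_on_Xs_bounded:
  fixes f :: "pt \<Rightarrow> 'a::real_normed_vector"
  assumes "continuous_on (Xs k) f"
  obtains K where "K > 0" "\<And>x. x \<in> Xs k \<Longrightarrow> norm (f x) \<le> K"
proof -
  have "bounded (f ` Xs k)"
    using assms compact_Xs compact_continuous_image compact_imp_bounded by blast
  then show ?thesis
    using that unfolding bounded_pos by (auto simp: image_iff)
qed

lemma lam_inv_pos:
  assumes "\<And>z. z \<in> Xs k \<Longrightarrow> w z > 0" "x \<in> Xs k"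
  shows "lam_inv w n x > 0"
  unfolding lam_inv_def by (intro prod_pos assms(1) shift_in_Xs assms(2))

section \<open>Hoelder regularity and bounded distortion\<close>

text \<open>Hoelder continuity as geometric decay of the variation on cylinders of length
  \<open>n\<close>; an exponent \<alpha> for \<open>dX\<close> corresponds to the rate
  \<open>r = (1/2) powr \<alpha>\<close>.\<close>

definition cyl_holder :: "nat \<Rightarrow> (pt \<Rightarrow> real) \<Rightarrow> bool" where
  "cyl_holder k f \<longleftrightarrow> (\<exists>C r. C \<ge> 0 \<and> 0 < r \<and> r < 1 \<and>
     (\<forall>n. \<forall>x\<in>Xs k. \<forall>y\<in>Xs k. (\<forall>i<n. x i = y i) \<longrightarrow> \<bar>f x - f y\<bar> \<le> C * r ^ n))"

lemma holderX_imp_cyl_holder: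
  assumes "holderX k f"
  shows "cyl_holder k f"
proof -
  obtain C \<alpha> where \<alpha>: "\<alpha> > 0"
    and C: "\<And>x y. x \<in> Xs k \<Longrightarrow> y \<in> Xs k \<Longrightarrow> \<bar>f x - f y\<bar> \<le> C * dX x y powr \<alpha>"
    using assms unfolding holderX_def by blast
  \<comment> \<open>The constant of \<open>holderX\<close> carries no sign condition, hence the
    absolute value.\<close>
  have "\<bar>f x - f y\<bar> \<le> \<bar>C\<bar> * ((1/2) powr \<alpha>) ^ n"
    if "x \<in> Xs k" "y \<in> Xs k" "\<forall>i<n. x i = y i" for n x y
  proof -
    have "dX x y \<ge> 0" by (simp add: dX_def)
    then have "dX x y powr \<alpha> \<le> ((1/2) ^ n) powr \<alpha>"
      using \<alpha> that(3) by (intro powr_mono2 dX_le) auto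
    also have "\<dots> = ((1/2) powr \<alpha>) ^ n"
      by (simp add: powr_power powr_realpow[symmetric] powr_powr mult.commute)
    finally have "\<bar>C\<bar> * dX x y powr \<alpha> \<le> \<bar>C\<bar> * ((1/2) powr \<alpha>) ^ n"
      by (intro mult_left_mono) auto
    moreover have "C * dX x y powr \<alpha> \<le> \<bar>C\<bar> * dX x y powr \<alpha>"
      by (intro mult_right_mono) auto
    ultimately show ?thesis using C[OF that(1,2)] by linarith
  qed
  moreover have "(1/2::real) powr \<alpha> < 1"
    using \<alpha> powr01_less_one[of "1/2" \<alpha>] by simp
  ultimately show ?thesis
    unfolding cyl_holder_def by (intro exI[of _ "\<bar>C\<bar>"] exI[of _ "(1/2) powr \<alpha>"]) auto
qed

lemma cyl_holder_continuous_on: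
  assumes "cyl_holder k f"
  shows "continuous_on (Xs k) f"
proof -
  obtain C r where C: "C \<ge> 0" "0 < r" "r < 1"
    and f: "\<And>n x y. x \<in> Xs k \<Longrightarrow> y \<in> Xs k \<Longrightarrow> \<forall>i<n. x i = y i \<Longrightarrow> \<bar>f x - f y\<bar> \<le> C * r ^ n"
    using assms unfolding cyl_holder_def by blast
  have "contX k f"
    unfolding contX_def
  proof (intro ballI allI impI)
    fix x and e :: real assume x: "x \<in> Xs k" and e: "e > 0"
    obtain n where "r ^ n < e / (C + 1)"
      using real_arch_pow_inv[of "e / (C + 1)" r] e C by auto
    then have n: "(C + 1) * r ^ n < e"
      using C(1) by (simp add: field_simps)
    have "dist (f y) (f x) < e" if y: "y \<in> Xs k" "dX x y < (1/2) ^ n" for y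
    proof -
      have "\<bar>f x - f y\<bar> \<le> C * r ^ n"
        using f[OF x y(1), of n] dX_less_agree[OF y(2)] by auto
      also have "\<dots> \<le> (C + 1) * r ^ n"
        using C by (intro mult_right_mono) auto
      finally show ?thesis using n by (simp add: dist_real_def abs_minus_commute)
    qed
    then show "\<exists>d>0. \<forall>y\<in>Xs k. dX x y < d \<longrightarrow> dist (f y) (f x) < e"
      by (intro exI[of _ "(1/2) ^ n"]) auto
  qed
  then show ?thesis by (simp add: contX_iff_continuous_on)
qed

text \<open>By compactness \<open>H\<close> has a positive minimum \<open>H x0\<close>, and the
  logarithm is Lipschitz with constant \<open>1 / H x0\<close> above it. The empty space is treated
  apart because the minimum needs a point.\<close>

lemma cyl_holder_ln:
  assumes H: "cyl_holder k H" and pos: "\<And>x. x \<in> Xs k \<Longrightarrow> H x > 0"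
  shows "cyl_holder k (\<lambda>x. a * ln (H x))"
proof (cases "Xs k = {}")
  case True
  then show ?thesis by (auto simp: cyl_holder_def intro!: exI[of _ 0] exI[of _ "1/2"])
next
  case False
  obtain C r where C: "C \<ge> 0" "0 < r" "r < 1"
    and f: "\<And>n x y. x \<in> Xs k \<Longrightarrow> y \<in> Xs k \<Longrightarrow> \<forall>i<n. x i = y i \<Longrightarrow> \<bar>H x - H y\<bar> \<le> C * r ^ n"
    using H unfolding cyl_holder_def by blast
  obtain x0 where x0: "x0 \<in> Xs k" "\<And>x. x \<in> Xs k \<Longrightarrow> H x0 \<le> H x"
    using continuous_attains_inf[OF compact_Xs False cyl_holder_continuous_on[OF H]] by blast
  have ln_le: "ln (H x) - ln (H y) \<le> \<bar>H x - H y\<bar> / H x0" if "x \<in> Xs k" "y \<in> Xs k" for x y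
  proof -
    have "ln (H x) - ln (H y) \<le> (H x - H y) / H y"
      using pos that by (intro ln_diff_le)
    also have "\<dots> \<le> \<bar>H x - H y\<bar> / H y"
      using pos that by (intro divide_right_mono) (auto intro: less_imp_le)
    also have "\<dots> \<le> \<bar>H x - H y\<bar> / H x0"
      using pos x0 that by (intro divide_left_mono mult_pos_pos) auto
    finally show ?thesis .
  qed
  have "\<bar>a * ln (H x) - a * ln (H y)\<bar> \<le> (\<bar>a\<bar> * (C / H x0)) * r ^ n"
    if "x \<in> Xs k" "y \<in> Xs k" "\<forall>i<n. x i = y i" for n x y
  proof -
    have "\<bar>ln (H x) - ln (H y)\<bar> \<le> \<bar>H x - H y\<bar> / H x0"
      using ln_le[of x y] ln_le[of y x] that by (auto simp: abs_minus_commute abs_le_iff)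
    also have "\<dots> \<le> C * r ^ n / H x0"
      using f[OF that] pos[OF x0(1)] by (intro divide_right_mono) auto
    finally have "\<bar>a\<bar> * \<bar>ln (H x) - ln (H y)\<bar> \<le> \<bar>a\<bar> * (C * r ^ n / H x0)"
      by (intro mult_left_mono) auto
    then show ?thesis by (simp add: abs_mult[symmetric] right_diff_distrib)
  qed
  moreover have "\<bar>a\<bar> * (C / H x0) \<ge> 0" using C pos[OF x0(1)] by auto
  ultimately show ?thesis using C unfolding cyl_holder_def by blast
qed

lemma lam_inv_exp: "lam_inv (\<lambda>z. exp (A z)) n x = exp (\<Sum>j<n. A ((shift ^^ j) x))"
  by (simp add: lam_inv_def exp_sum)

text \<open>After \<open>j\<close> steps the two points still share \<open>n - j\<close> coordinates
  of \<open>v\<close>, so the Birkhoff sums differ by at most a geometric series. Its total does not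
  depend on \<open>n\<close>, and this uniformity drives the contraction below.\<close>

lemma bounded_distortion:
  assumes "cyl_holder k A"
  obtains B where "B \<ge> 1" "\<And>n v x y. v \<in> words k n \<Longrightarrow> x \<in> Xs k \<Longrightarrow> y \<in> Xs k \<Longrightarrow>
    lam_inv (\<lambda>z. exp (A z)) n (cat n v x) \<le> B * lam_inv (\<lambda>z. exp (A z)) n (cat n v y)"
proof -
  obtain C r where C: "C \<ge> 0" "0 < r" "r < 1"
    and A: "\<And>n x y. x \<in> Xs k \<Longrightarrow> y \<in> Xs k \<Longrightarrow> \<forall>i<n. x i = y i \<Longrightarrow> \<bar>A x - A y\<bar> \<le> C * r ^ n"
    using assms unfolding cyl_holder_def by blast
  show ?thesis
  proof (rule that[of "exp (C / (1 - r))"])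
    show "1 \<le> exp (C / (1 - r))" using C by simp
  next
    fix n v x y assume v: "v \<in> words k n" and x: "x \<in> Xs k" and y: "y \<in> Xs k"
    have "(\<Sum>j<n. A ((shift ^^ j) (cat n v x))) - (\<Sum>j<n. A ((shift ^^ j) (cat n v y)))
        \<le> (\<Sum>j<n. C * r ^ (n - Suc j))"
      unfolding sum_subtractf[symmetric]
    proof (rule sum_mono)
      fix j assume "j \<in> {..<n}"
      have "\<bar>A ((shift ^^ j) (cat n v x)) - A ((shift ^^ j) (cat n v y))\<bar> \<le> C * r ^ (n - j)"
        using v x y by (intro A shift_in_Xs cat_in_Xs) (auto simp: shift_funpow cat_def)
      \<comment> \<open>One power of \<open>r\<close> is given away so that the exponents become
        those of the reversed sum of \<open>r ^ j\<close> over \<open>j < n\<close>.\<close>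
      also have "\<dots> \<le> C * r ^ (n - Suc j)"
        using C by (intro mult_left_mono power_decreasing) auto
      finally show "A ((shift ^^ j) (cat n v x)) - A ((shift ^^ j) (cat n v y)) \<le> C * r ^ (n - Suc j)"
        by linarith
    qed
    also have "\<dots> = C * (\<Sum>j<n. r ^ j)"
      by (subst sum.nat_diff_reindex) (simp add: sum_distrib_left)
    also have "\<dots> = C * ((1 - r ^ n) / (1 - r))"
      using C by (subst sum_gp_strict) auto
    also have "\<dots> \<le> C / (1 - r)"
      using C by (simp add: divide_right_mono mult_left_le)
    finally show "lam_inv (\<lambda>z. exp (A z)) n (cat n v x)
        \<le> exp (C / (1 - r)) * lam_inv (\<lambda>z. exp (A z)) n (cat n v y)"
      by (simp add: lam_inv_exp exp_add[symmetric])
  qed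
qed

section \<open>Contraction of the ratio of iterates\<close>

text \<open>A Doeblin minorisation: from \<open>W \<ge> W0 / K\<close> and
  \<open>sum W V \<le> K * sum W0 V\<close>, the normalised weights \<open>W\<close> dominate
  \<open>1 / K\<^sup>2\<close> times the normalised \<open>W0\<close>. That share of the
  \<open>W\<close>-average of \<open>G\<close> is therefore the fixed number \<open>s\<close>, and
  the rest is at most \<open>b\<close>.\<close>

lemma weighted_sum_contraction:
  fixes W W0 G :: "'a \<Rightarrow> real"
  assumes fin: "finite V" "V \<noteq> {}" and pos: "\<And>v. v \<in> V \<Longrightarrow> W v > 0" "\<And>v. v \<in> V \<Longrightarrow> W0 v > 0"
    and K: "K > 0" "\<And>v. v \<in> V \<Longrightarrow> W v \<le> K * W0 v" "\<And>v. v \<in> V \<Longrightarrow> W0 v \<le> K * W v"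
    and G: "\<And>v. v \<in> V \<Longrightarrow> G v \<le> b"
  defines "s \<equiv> (\<Sum>v\<in>V. W0 v * G v) / sum W0 V"
  shows "(\<Sum>v\<in>V. W v * G v) \<le> (s / K\<^sup>2 + (1 - 1 / K\<^sup>2) * b) * sum W V"
proof -
  define Z where "Z = sum W V"
  define Z0 where "Z0 = sum W0 V"
  have Z: "Z > 0" "Z0 > 0" unfolding Z_def Z0_def using fin pos by (auto intro: sum_pos)
  have "Z \<le> K * Z0"
    unfolding Z_def Z0_def sum_distrib_left by (intro sum_mono K)
  then have ZZ: "Z / Z0 / K\<^sup>2 \<le> 1 / K"
    using Z K(1) by (simp add: field_simps power2_eq_square)
  have expand: "(\<Sum>v\<in>V. (W v - c * W0 v) * (b - G v))
      = b * sum W V - (\<Sum>v\<in>V. W v * G v) - c * (b * sum W0 V - (\<Sum>v\<in>V. W0 v * G v))" for c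
    by (simp add: algebra_simps sum.distrib sum_subtractf sum_distrib_left)
  \<comment> \<open>Both factors are nonnegative: the first by the minorisation, the second by the
    bound on \<open>G\<close>. Expanding the sum is the claim.\<close>
  have "0 \<le> (\<Sum>v\<in>V. (W v - Z / Z0 / K\<^sup>2 * W0 v) * (b - G v))"
  proof (intro sum_nonneg mult_nonneg_nonneg)
    fix v assume v: "v \<in> V"
    have "Z / Z0 / K\<^sup>2 * W0 v \<le> 1 / K * W0 v"
      using ZZ pos(2)[OF v] by (intro mult_right_mono) auto
    also have "\<dots> \<le> W v" using K(3)[OF v] K(1) by (simp add: field_simps)
    finally show "0 \<le> W v - Z / Z0 / K\<^sup>2 * W0 v" by simp
    show "0 \<le> b - G v" using G[OF v] by simp
  qed
  also have "\<dots> = b * Z - (\<Sum>v\<in>V. W v * G v) - Z / Z0 / K\<^sup>2 * (b * Z0 - (\<Sum>v\<in>V. W0 v * G v))"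
    unfolding Z_def Z0_def by (rule expand)
  also have "\<dots> = b * Z - (\<Sum>v\<in>V. W v * G v) - Z / K\<^sup>2 * (b - s)"
    using Z unfolding s_def Z0_def[symmetric] by (simp add: field_simps)
  finally show ?thesis unfolding Z_def[symmetric] by (simp add: algebra_simps diff_divide_distrib)
qed

lemma words_nonempty: "Xs k \<noteq> {} \<Longrightarrow> words k n \<noteq> {}"
  using restrict_in_words by blast

lemma LL_funpow_pos:
  fixes f :: "pt \<Rightarrow> real"
  assumes "\<And>z. z \<in> Xs k \<Longrightarrow> w z > 0" "\<And>z. z \<in> Xs k \<Longrightarrow> f z > 0" "x \<in> Xs k"
  shows "(LL k w ^^ n) f x > 0"
proof -
  have "words k n \<noteq> {}" using assms(3) words_nonempty by blast
  then show ?thesis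
    using lam_inv_pos[of k w, OF assms(1)]
    by (auto simp: LL_funpow assms cat_in_Xs intro!: sum_pos)
qed

text \<open>With \<open>g = L\<^sup>n f / L\<^sup>n 1\<close>, the ratio \<open>L\<^bsup>m+n\<^esup> f / L\<^bsup>m+n\<^esup> 1\<close> at \<open>x\<close> averages \<open>g\<close> over \<open>T\<^bsup>-m\<^esup> x\<close>; for large \<open>m\<close>
  the values of \<open>g\<close> hardly depend on \<open>x\<close>, and distortion makes the weights at any two base points comparable
  with a constant that does not depend on \<open>m\<close> and \<open>n\<close>.\<close>
lemma LL_ratio_contraction:
  fixes f :: "pt \<Rightarrow> real"
  assumes w: "\<And>z. z \<in> Xs k \<Longrightarrow> w z > 0" and wc: "continuous_on (Xs k) w"
    and B: "B \<ge> 1" "\<And>n v x y. v \<in> words k n \<Longrightarrow> x \<in> Xs k \<Longrightarrow> y \<in> Xs k \<Longrightarrow>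
       lam_inv w n (cat n v x) \<le> B * lam_inv w n (cat n v y)"
    and fc: "continuous_on (Xs k) f" and ne: "Xs k \<noteq> {}"
    and ab: "\<And>x. x \<in> Xs k \<Longrightarrow> a * (LL k w ^^ n) (\<lambda>_. 1) x \<le> (LL k w ^^ n) f x"
      "\<And>x. x \<in> Xs k \<Longrightarrow> (LL k w ^^ n) f x \<le> b * (LL k w ^^ n) (\<lambda>_. 1) x"
    and \<Delta>: "b - a \<le> \<Delta>" "\<Delta> > 0"
  obtains N a' b' where "b' - a' \<le> (1 - 1 / (2 * B ^ 4)) * \<Delta>"
    "\<And>x. x \<in> Xs k \<Longrightarrow> a' * (LL k w ^^ N) (\<lambda>_. 1) x \<le> (LL k w ^^ N) f x"
    "\<And>x. x \<in> Xs k \<Longrightarrow> (LL k w ^^ N) f x \<le> b' * (LL k w ^^ N) (\<lambda>_. 1) x"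
proof -
  define L1 where "L1 = (LL k w ^^ n) (\<lambda>_. 1 :: real)"
  define Lf where "Lf = (LL k w ^^ n) f"
  define g where "g x = Lf x / L1 x" for x
  have L1_pos: "L1 x > 0" if "x \<in> Xs k" for x
    unfolding L1_def using w that by (intro LL_funpow_pos) auto
  \<comment> \<open>Distortion holds branch by branch, so it survives summation over the
    words.\<close>
  have L1_dist: "L1 x \<le> B * L1 y" if "x \<in> Xs k" "y \<in> Xs k" for x y
    using B(2) that by (auto simp: L1_def LL_funpow sum_distrib_left intro!: sum_mono)
  have g_cont: "continuous_on (Xs k) g"
    unfolding g_def L1_def Lf_def using L1_pos
    by (intro continuous_intros continuous_on_LL_funpow wc fc) (force simp: L1_def)
  have g_bounds: "a \<le> g x" "g x \<le> b" if "x \<in> Xs k" for x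
    using ab[OF that] L1_pos[OF that] by (auto simp: g_def L1_def[symmetric] Lf_def[symmetric] field_simps)
  \<comment> \<open>The weights \<open>W\<close> below are products of two factors, each distorted
    by at most \<open>B\<close>. They are comparable with constant \<open>B\<^sup>2\<close>, whose
    inverse square is the common share of the averages.\<close>
  define c where "c = 1 / (B\<^sup>2)\<^sup>2"
  have c: "c > 0" using B(1) by (auto simp: c_def)
  \<comment> \<open>Replacing \<open>g\<close> by its values over \<open>x0\<close> costs
    \<open>e\<close> at either end, together \<open>c * \<Delta> / 2\<close>. Of the gain
    \<open>c * \<Delta>\<close> half is left, which is the rate
    \<open>1 - 1 / (2 * B ^ 4)\<close>.\<close>
  define e where "e = c * \<Delta> / 4"
  have e: "e > 0" using c \<Delta> by (simp add: e_def)
  \<comment> \<open>Points of the form \<open>cat m v x\<close> and \<open>cat m v x0\<close> share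
    the prefix \<open>v\<close>, so this length makes \<open>g\<close> nearly independent of the
    base point on each branch.\<close>
  obtain m where m: "\<And>x y. x \<in> Xs k \<Longrightarrow> y \<in> Xs k \<Longrightarrow> (\<forall>i<m. x i = y i) \<Longrightarrow> dist (g x) (g y) < e"
    using continuous_on_Xs_uniform[OF g_cont e] by metis
  obtain x0 where x0: "x0 \<in> Xs k" using ne by blast
  let ?V = "words k m"
  define W where "W x v = lam_inv w m (cat m v x) * L1 (cat m v x)" for x v
  define G where "G v = g (cat m v x0)" for v
  define s where "s = (\<Sum>v\<in>?V. W x0 v * G v) / sum (W x0) ?V"
  have W_pos: "W x v > 0" if "x \<in> Xs k" "v \<in> ?V" for x v
    unfolding W_def using w that by (intro mult_pos_pos lam_inv_pos[of k] L1_pos cat_in_Xs)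
  have W_dist: "W x v \<le> B\<^sup>2 * W y v" if "x \<in> Xs k" "y \<in> Xs k" "v \<in> ?V" for x y v
  proof -
    have "W x v \<le> (B * lam_inv w m (cat m v y)) * (B * L1 (cat m v y))"
      unfolding W_def using that B lam_inv_pos[of k w, OF w] L1_pos
      by (intro mult_mono L1_dist cat_in_Xs B(2)) (auto simp: cat_in_Xs less_imp_le)
    then show ?thesis by (simp add: W_def power2_eq_square ac_simps)
  qed
  have L1_sum: "(LL k w ^^ (m + n)) (\<lambda>_. 1) x = sum (W x) ?V" if "x \<in> Xs k" for x
    by (simp add: funpow_add LL_funpow[OF that] W_def L1_def[symmetric])
  have Lf_sum: "(LL k w ^^ (m + n)) f x = (\<Sum>v\<in>?V. W x v * g (cat m v x))" if "x \<in> Xs k" for x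
  proof -
    have "L1 (cat m v x) \<noteq> 0" if "v \<in> ?V" for v
      using L1_pos[OF cat_in_Xs[OF that \<open>x \<in> Xs k\<close>]] by simp
    then show ?thesis
      by (auto simp: funpow_add LL_funpow[OF that] W_def g_def Lf_def[symmetric] intro!: sum.cong)
  qed
  have G_close: "\<bar>g (cat m v x) - G v\<bar> \<le> e" if "x \<in> Xs k" "v \<in> ?V" for x v
  proof -
    have "dist (g (cat m v x)) (g (cat m v x0)) < e"
      using that x0 by (intro m cat_in_Xs) (auto simp: cat_def)
    then show ?thesis by (simp add: G_def dist_real_def)
  qed
  show ?thesis
  \<comment> \<open>The term \<open>s * c\<close> occurs in both bounds and cancels in their
    difference; only the share \<open>1 - c\<close> keeps the old oscillation.\<close>
  proof (rule that[of "s * c + (1 - c) * b + e" "s * c + (1 - c) * a - e" "m + n"])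
    have "s * c + (1 - c) * b + e - (s * c + (1 - c) * a - e) = (1 - c) * (b - a) + 2 * e"
      by (simp add: algebra_simps)
    also have "\<dots> \<le> (1 - c) * \<Delta> + 2 * e"
      using \<Delta> B(1) by (intro add_right_mono mult_left_mono) (auto simp: c_def)
    also have "\<dots> = (1 - 1 / (2 * B ^ 4)) * \<Delta>"
      by (simp add: e_def c_def algebra_simps flip: power_mult)
    finally show "s * c + (1 - c) * b + e - (s * c + (1 - c) * a - e) \<le> (1 - 1 / (2 * B ^ 4)) * \<Delta>" .
  next
    fix x assume x: "x \<in> Xs k"
    have fin: "finite ?V" "?V \<noteq> {}" using words_nonempty[OF ne] by auto
    \<comment> \<open>The lower bound is the upper bound for \<open>- G\<close> with
      \<open>- a\<close> in place of \<open>b\<close>.\<close>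
    have "(\<Sum>v\<in>?V. W x v * (- G v)) \<le> ((\<Sum>v\<in>?V. W x0 v * (- G v)) / sum (W x0) ?V / (B\<^sup>2)\<^sup>2
        + (1 - 1 / (B\<^sup>2)\<^sup>2) * (- a)) * sum (W x) ?V"
      using fin W_pos x x0 W_dist B(1) g_bounds
      by (intro weighted_sum_contraction) (auto simp: G_def cat_in_Xs)
    then have low: "(s * c + (1 - c) * a) * sum (W x) ?V \<le> (\<Sum>v\<in>?V. W x v * G v)"
      by (simp add: s_def c_def sum_negf algebra_simps)
    have "(\<Sum>v\<in>?V. W x v * G v) \<le> (s / (B\<^sup>2)\<^sup>2 + (1 - 1 / (B\<^sup>2)\<^sup>2) * b) * sum (W x) ?V"
      unfolding s_def using fin W_pos x x0 W_dist B(1) g_bounds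
      by (intro weighted_sum_contraction) (auto simp: G_def cat_in_Xs)
    then have upp: "(\<Sum>v\<in>?V. W x v * G v) \<le> (s * c + (1 - c) * b) * sum (W x) ?V"
      by (simp add: c_def)
    have "(\<Sum>v\<in>?V. W x v * (G v - e)) \<le> (\<Sum>v\<in>?V. W x v * g (cat m v x))"
      using G_close[OF x] W_pos[OF x]
      by (intro sum_mono mult_left_mono) (force simp: less_imp_le abs_le_iff algebra_simps)+
    then show "(s * c + (1 - c) * a - e) * (LL k w ^^ (m + n)) (\<lambda>_. 1) x \<le> (LL k w ^^ (m + n)) f x"
      using low unfolding L1_sum[OF x] Lf_sum[OF x]
      by (simp add: algebra_simps sum_subtractf sum.distrib sum_distrib_left)
    have "(\<Sum>v\<in>?V. W x v * g (cat m v x)) \<le> (\<Sum>v\<in>?V. W x v * (G v + e))"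
      using G_close[OF x] W_pos[OF x]
      by (intro sum_mono mult_left_mono) (force simp: less_imp_le abs_le_iff algebra_simps)+
    then show "(LL k w ^^ (m + n)) f x \<le> (s * c + (1 - c) * b + e) * (LL k w ^^ (m + n)) (\<lambda>_. 1) x"
      using upp unfolding L1_sum[OF x] Lf_sum[OF x]
      by (simp add: algebra_simps sum.distrib sum_distrib_left)
  qed
qed

text \<open>The contraction factor depends on \<open>B\<close> alone, so it can be iterated. The
  start is \<open>n = 0\<close>, where the ratio is \<open>f\<close> itself and lies between
  \<open>- K\<close> and \<open>K\<close>.\<close>

lemma LL_ratio_oscillation:
  fixes f :: "pt \<Rightarrow> real"
  assumes A: "cyl_holder k A" and fc: "continuous_on (Xs k) f" and ne: "Xs k \<noteq> {}" and \<delta>: "\<delta> > 0"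
  defines "w \<equiv> \<lambda>z. exp (A z)"
  obtains n a b where "b - a \<le> \<delta>"
    "\<And>x. x \<in> Xs k \<Longrightarrow> a * (LL k w ^^ n) (\<lambda>_. 1) x \<le> (LL k w ^^ n) f x"
    "\<And>x. x \<in> Xs k \<Longrightarrow> (LL k w ^^ n) f x \<le> b * (LL k w ^^ n) (\<lambda>_. 1) x"
proof -
  obtain B where B: "B \<ge> 1" "\<And>n v x y. v \<in> words k n \<Longrightarrow> x \<in> Xs k \<Longrightarrow> y \<in> Xs k \<Longrightarrow>
      lam_inv w n (cat n v x) \<le> B * lam_inv w n (cat n v y)"
    using bounded_distortion[OF A] unfolding w_def by metis
  have wc: "continuous_on (Xs k) w"
    unfolding w_def by (intro continuous_intros cyl_holder_continuous_on A)
  obtain K where K: "K > 0" "\<And>x. x \<in> Xs k \<Longrightarrow> norm (f x) \<le> K"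
    using continuous_on_Xs_bounded[OF fc] by metis
  define q where "q = 1 - 1 / (2 * B ^ 4)"
  have "2 * B ^ 4 > 1" using one_le_power[OF B(1), of 4] by linarith
  then have q: "0 < q" "q < 1"
    using B(1) by (auto simp: q_def divide_less_eq_1)
  have "\<exists>n a b. b - a \<le> q ^ j * (2 * K) \<and> (\<forall>x\<in>Xs k. a * (LL k w ^^ n) (\<lambda>_. 1) x \<le> (LL k w ^^ n) f x
      \<and> (LL k w ^^ n) f x \<le> b * (LL k w ^^ n) (\<lambda>_. 1) x)" for j
  proof (induction j)
    case 0
    have "-K \<le> f x \<and> f x \<le> K" if "x \<in> Xs k" for x
      using K(2)[OF that] by (auto simp: abs_le_iff)
    then show ?case
      by (intro exI[of _ 0] exI[of _ "-K"] exI[of _ K]) auto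
  next
    case (Suc j)
    then obtain n a b where ab: "b - a \<le> q ^ j * (2 * K)"
      "\<And>x. x \<in> Xs k \<Longrightarrow> a * (LL k w ^^ n) (\<lambda>_. 1) x \<le> (LL k w ^^ n) f x"
      "\<And>x. x \<in> Xs k \<Longrightarrow> (LL k w ^^ n) f x \<le> b * (LL k w ^^ n) (\<lambda>_. 1) x" by blast
    \<comment> \<open>The induction tracks a positive bound on the gap and not the gap itself, since
      the tolerance of the contraction step must be positive even if \<open>a = b\<close>.\<close>
    have pos: "q ^ j * (2 * K) > 0" using q K(1) by simp
    have w: "w z > 0" for z by (simp add: w_def)
    show ?case
    proof (rule LL_ratio_contraction[of k w B f a n b "q ^ j * (2 * K)"])
      fix N a' b'
      assume "b' - a' \<le> (1 - 1 / (2 * B ^ 4)) * (q ^ j * (2 * K))"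
        "\<And>x. x \<in> Xs k \<Longrightarrow> a' * (LL k w ^^ N) (\<lambda>_. 1) x \<le> (LL k w ^^ N) f x"
        "\<And>x. x \<in> Xs k \<Longrightarrow> (LL k w ^^ N) f x \<le> b' * (LL k w ^^ N) (\<lambda>_. 1) x"
      then show ?case
        by (intro exI[of _ N] exI[of _ a'] exI[of _ b']) (auto simp: q_def mult.assoc)
    qed (rule w wc B fc ne ab pos | assumption)+
  qed
  moreover obtain j where "q ^ j < \<delta> / (2 * K)"
    using real_arch_pow_inv[of "\<delta> / (2 * K)" q] q K(1) \<delta> by auto
  then have "q ^ j * (2 * K) \<le> \<delta>" using K(1) by (simp add: field_simps)
  ultimately show ?thesis
    using that by (meson order_trans)
qed

section \<open>Measurability and invariance of the Gibbs state\<close>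

text \<open>Keeps \<open>1\<close> from becoming \<open>Suc 0\<close>, so that facts about
  \<open>words k 1\<close>, \<open>cat 1 v\<close> and \<open>shift ^^ 1\<close> continue to
  match.\<close>

declare One_nat_def [simp del]

lemma funpow_1 [simp]: "(f :: 'a \<Rightarrow> 'a) ^^ 1 = f"
  by (simp add: One_nat_def)

lemma space_borelX: "sets M = sets (borelX k) \<Longrightarrow> space M = Xs k"
proof -
  assume "sets M = sets (borelX k)"
  then have "space M = space (borelX k)" by (rule sets_eq_imp_space_eq)
  also have "\<dots> = Xs k" by (auto simp: borelX_def cylinders_def space_measure_of_conv)
  finally show ?thesis .
qed

lemma cylinders_subset: "cylinders k \<subseteq> Pow (Xs k)"
  by (auto simp: cylinders_def)

lemma sets_borelX: "sets (borelX k) = sigma_sets (Xs k) (cylinders k)"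
  by (simp add: borelX_def cylinders_subset)

lemma Xs_in_cylinders: "Xs k \<in> cylinders k"
  by (auto simp: cylinders_def intro!: exI[of _ 0])

text \<open>Any point common to two cylinders names the intersection as a cylinder of the larger
  length. This is the generator for the Dynkin argument in
  \<open>sum_emeasure_branch\<close>.\<close>

lemma Int_stable_cylinders: "Int_stable (insert {} (cylinders k))"
proof -
  have *: "{x\<in>Xs k. \<forall>i<m. x i = v i} \<inter> {x\<in>Xs k. \<forall>i<n. x i = w i} \<in> insert {} (cylinders k)" for m n v w
  proof (cases "{x\<in>Xs k. \<forall>i<m. x i = v i} \<inter> {x\<in>Xs k. \<forall>i<n. x i = w i} = {}")
    case False
    then obtain y where "y \<in> Xs k" "\<forall>i<m. y i = v i" "\<forall>i<n. y i = w i" by blast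
    then have "{x\<in>Xs k. \<forall>i<m. x i = v i} \<inter> {x\<in>Xs k. \<forall>i<n. x i = w i} = {x\<in>Xs k. \<forall>i<max m n. x i = y i}"
      by (auto simp: less_max_iff_disj)
    moreover have "{x\<in>Xs k. \<forall>i<max m n. x i = y i} \<in> cylinders k"
      unfolding cylinders_def by blast
    ultimately show ?thesis by simp
  qed simp
  show ?thesis
  proof (rule Int_stableI)
    fix A B assume "A \<in> insert {} (cylinders k)" "B \<in> insert {} (cylinders k)"
    then consider "A = {} \<or> B = {}" | m v n w where
      "A = {x\<in>Xs k. \<forall>i<m. x i = v i}" "B = {x\<in>Xs k. \<forall>i<n. x i = w i}"
      unfolding cylinders_def by blast
    then show "A \<inter> B \<in> insert {} (cylinders k)"
      by cases (use * in auto)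
  qed
qed

lemma word_cylinder: "{x\<in>Xs k. \<forall>i<n. x i = w i} = {x\<in>Xs k. restrict x {..<n} = restrict w {..<n}}"
  by (auto simp: restrict_def fun_eq_iff)

lemma word_cylinder_sets:
  assumes "sets M = sets (borelX k)"
  shows "{x\<in>Xs k. restrict x {..<n} = v} \<in> sets M"
proof (cases "v = restrict v {..<n}")
  case True
  have "{x\<in>Xs k. \<forall>i<n. x i = v i} \<in> sets M"
    unfolding assms sets_borelX by (rule sigma_sets.Basic) (auto simp: cylinders_def)
  then show ?thesis
    unfolding word_cylinder using True by simp
next
  case False
  \<comment> \<open>A non-extensional \<open>v\<close> is never a restriction, so the set is
    empty.\<close>
  have "v = restrict v {..<n}" if "v = restrict x {..<n}" for x
    unfolding that by simp
  with False have "{x\<in>Xs k. restrict x {..<n} = v} = {}" by blast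
  then show ?thesis by (simp only: sets.empty_sets)
qed

text \<open>The sigma-algebra is generated by cylinders, so measurability is obtained from functions
  of finitely many coordinates: \<open>f\<close> is the pointwise limit of its values at
  \<open>x\<close> with the tail after \<open>n\<close> letters replaced by that of a fixed point
  \<open>c\<close>.\<close>

lemma borel_measurable_continuous_Xs:
  fixes f :: "pt \<Rightarrow> 'a::real_normed_vector"
  assumes M: "sets M = sets (borelX k)" and f: "continuous_on (Xs k) f"
  shows "f \<in> borel_measurable M"
proof (cases "Xs k = {}")
  case True
  then show ?thesis
    by (simp add: measurable_def space_borelX[OF M])
next
  case False
  then obtain c where c: "c \<in> Xs k" by blast
  show ?thesis
  proof (rule borel_measurable_LIMSEQ_metric)
    fix n
    have "(\<lambda>x. restrict x {..<n}) \<in> measurable M (count_space (words k n))"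
      unfolding measurable_count_space_eq2[OF finite_words]
    proof (intro conjI ballI)
      fix v assume "v \<in> words k n"
      have "(\<lambda>x. restrict x {..<n}) -` {v} \<inter> space M = {x\<in>Xs k. restrict x {..<n} = v}"
        by (auto simp: space_borelX[OF M])
      then show "(\<lambda>x. restrict x {..<n}) -` {v} \<inter> space M \<in> sets M"
        by (simp only: word_cylinder_sets[OF M])
    qed (auto simp: space_borelX[OF M] restrict_in_words)
    then show "(\<lambda>x. f (cat n (restrict x {..<n}) c)) \<in> borel_measurable M"
      by (rule measurable_compose) simp
  next
    fix x assume "x \<in> space M"
    then have x: "x \<in> Xs k" by (simp add: space_borelX[OF M])
    show "(\<lambda>n. f (cat n (restrict x {..<n}) c)) \<longlonglongrightarrow> f x"
    proof (rule metric_LIMSEQ_I)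
      fix e :: real assume "e > 0"
      from continuous_on_Xs_uniform[OF f this] obtain N where
        N: "\<And>x y. x \<in> Xs k \<Longrightarrow> y \<in> Xs k \<Longrightarrow> (\<forall>i<N. x i = y i) \<Longrightarrow> dist (f x) (f y) < e" by metis
      have "dist (f (cat n (restrict x {..<n}) c)) (f x) < e" if "n \<ge> N" for n
        using that x c by (intro N cat_in_Xs restrict_in_words) (auto simp: cat_def)
      then show "\<exists>N. \<forall>n\<ge>N. dist (f (cat n (restrict x {..<n}) c)) (f x) < e" by blast
    qed
  qed
qed

text \<open>The preimage of a cylinder is a level set of its indicator composed with
  \<open>f\<close>, a continuous function.\<close>

lemma measurable_continuous_Xs:
  assumes M: "sets M = sets (borelX k)"
    and f: "continuous_on (Xs k) f" "f ` Xs k \<subseteq> Xs k"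
  shows "f \<in> measurable M M"
proof (rule measurable_sigma_sets)
  show "sets M = sigma_sets (Xs k) (cylinders k)" using M by (simp add: sets_borelX)
  show "f \<in> space M \<rightarrow> Xs k" using f(2) by (auto simp: space_borelX[OF M])
  fix A assume "A \<in> cylinders k"
  then obtain n v where A: "A = {x\<in>Xs k. restrict x {..<n} = v}"
    unfolding cylinders_def word_cylinder by blast
  have "continuous_on (Xs k) (\<lambda>x. if restrict (f x) {..<n} = v then 1 else 0 :: real)"
    using continuous_on_compose2[OF continuous_on_word_indicator f] .
  then have "(\<lambda>x. if restrict (f x) {..<n} = v then 1 else 0 :: real) -` {1} \<inter> space M \<in> sets M"
    by (intro borel_measurable_vimage borel_measurable_continuous_Xs[OF M])
  also have "(\<lambda>x. if restrict (f x) {..<n} = v then 1 else 0 :: real) -` {1} \<inter> space M = f -` A \<inter> space M"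
    using f(2) by (auto simp: A space_borelX[OF M] split: if_splits)
  finally show "f -` A \<inter> space M \<in> sets M" .
qed (rule cylinders_subset)

lemma integrable_continuous_Xs:
  fixes f :: "pt \<Rightarrow> 'a::{banach, second_countable_topology}"
  assumes "prob_space M" and M: "sets M = sets (borelX k)" and f: "continuous_on (Xs k) f"
  shows "integrable M f"
proof -
  interpret prob_space M by fact
  obtain K where "\<And>x. x \<in> Xs k \<Longrightarrow> norm (f x) \<le> K"
    using continuous_on_Xs_bounded[OF f] by metis
  then show ?thesis
    by (intro integrable_const_bound[of _ K] AE_I2 borel_measurable_continuous_Xs[OF M f])
       (auto simp: space_borelX[OF M])
qed

section \<open>Invariance of the Gibbs state for measurable functions\<close>

locale gibbs_shift = prob_space \<mu> for \<mu> :: "pt measure" +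
  fixes k :: nat and p :: "pt \<Rightarrow> real"
  assumes p_pos: "\<And>x. x \<in> Xs k \<Longrightarrow> p x > 0"
    and p_cont: "continuous_on (Xs k) p"
    and p_norm: "\<And>x. x \<in> Xs k \<Longrightarrow> (\<Sum>z\<in>{z\<in>Xs k. shift z = x}. p z) = 1"
    and mu_sets: "sets \<mu> = sets (borelX k)"
    and mu_inv: "\<And>f::pt \<Rightarrow> complex. continuous_on (Xs k) f \<Longrightarrow> integral\<^sup>L \<mu> (LL k p f) = integral\<^sup>L \<mu> f"
begin

lemma space_mu: "space \<mu> = Xs k"
  by (rule space_borelX[OF mu_sets])

lemma Xs_nonempty: "Xs k \<noteq> {}"
  using not_empty by (simp add: space_mu)

lemma measurable_shift [measurable]: "shift \<in> measurable \<mu> \<mu>"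
  using continuous_on_shift[of "Xs k" 1] shift_in_Xs[of _ k 1]
  by (intro measurable_continuous_Xs[OF mu_sets]) auto

lemma measurable_cat: "v \<in> words k n \<Longrightarrow> cat n v \<in> measurable \<mu> \<mu>"
  by (intro measurable_continuous_Xs[OF mu_sets] continuous_on_cat) (auto simp: cat_in_Xs)

lemma measurable_p [measurable]: "p \<in> borel_measurable \<mu>"
  by (rule borel_measurable_continuous_Xs[OF mu_sets p_cont])

lemma LL_words: "x \<in> Xs k \<Longrightarrow> LL k w f x = (\<Sum>v\<in>words k 1. w (cat 1 v x) *\<^sub>R f (cat 1 v x))"
  using LL_funpow[of x k 1 w f] by (simp add: lam_inv_def)

lemma p_words: "x \<in> Xs k \<Longrightarrow> (\<Sum>v\<in>words k 1. p (cat 1 v x)) = 1"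
  using p_norm[of x] sum_preimage_shift[of x k p 1] by simp

text \<open>The part of the dual of \<open>LL k p\<close> applied to \<mu> that is carried by the
  cylinder of \<open>v\<close>. The sum over one-letter words is the whole dual measure.\<close>

definition branch :: "pt \<Rightarrow> pt measure" where
  "branch v = distr (density \<mu> (\<lambda>x. ennreal (p (cat 1 v x)))) \<mu> (cat 1 v)"

lemma nn_integral_branch:
  assumes v: "v \<in> words k 1" and f[measurable]: "f \<in> borel_measurable \<mu>"
  shows "(\<integral>\<^sup>+x. f x \<partial>branch v) = (\<integral>\<^sup>+x. ennreal (p (cat 1 v x)) * f (cat 1 v x) \<partial>\<mu>)"
proof -
  note [measurable] = measurable_cat[OF v]
  show ?thesis
    unfolding branch_def by (subst nn_integral_distr) (auto simp: nn_integral_density)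
qed

text \<open>The equation \<open>LL k p\<close> dual of \<mu> equals \<mu>, now between measures.
  Indicators of cylinders are continuous, so \<open>mu_inv\<close> settles the generator;
  complements and disjoint unions follow from additivity.\<close>

lemma sum_emeasure_branch:
  assumes "A \<in> sets \<mu>"
  shows "(\<Sum>v\<in>words k 1. emeasure (branch v) A) = emeasure \<mu> A"
proof -
  have em: "(\<Sum>v\<in>words k 1. emeasure (branch v) A)
      = (\<integral>\<^sup>+x. (\<Sum>v\<in>words k 1. ennreal (p (cat 1 v x)) * indicator A (cat 1 v x)) \<partial>\<mu>)"
    if A[measurable]: "A \<in> sets \<mu>" for A
  proof -
    have "emeasure (branch v) A = (\<integral>\<^sup>+x. ennreal (p (cat 1 v x)) * indicator A (cat 1 v x) \<partial>\<mu>)"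
      if "v \<in> words k 1" for v
      using nn_integral_branch[OF that, of "indicator A"] A by (simp add: branch_def)
    moreover have "(\<lambda>x. ennreal (p (cat 1 v x)) * indicator A (cat 1 v x)) \<in> borel_measurable \<mu>"
      if "v \<in> words k 1" for v
    proof -
      note [measurable] = measurable_cat[OF that]
      show ?thesis by measurable
    qed
    ultimately show ?thesis
      by (simp only: nn_integral_sum cong: sum.cong)
  qed
  have gen: "sets \<mu> = sigma_sets (Xs k) (insert {} (cylinders k))"
    unfolding mu_sets sets_borelX
    by (intro sigma_sets_eqI) (auto intro: sigma_sets.intros)
  have cyl: "(\<Sum>v\<in>words k 1. emeasure (branch v) A) = emeasure \<mu> A" if A_cyl: "A \<in> cylinders k" for A
  proof -
    obtain n v where A: "A = {x\<in>Xs k. restrict x {..<n} = v}"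
      using A_cyl unfolding cylinders_def word_cylinder by blast
    have A_meas: "A \<in> sets \<mu>" unfolding A by (rule word_cylinder_sets[OF mu_sets])
    define h :: "pt \<Rightarrow> complex" where "h x = (if restrict x {..<n} = v then 1 else 0)" for x
    define r where "r x = (\<Sum>u\<in>words k 1. p (cat 1 u x) * indicator A (cat 1 u x))" for x
    have r_nonneg: "r x \<ge> 0" if "x \<in> Xs k" for x
      unfolding r_def using p_pos that
      by (intro sum_nonneg mult_nonneg_nonneg) (auto simp: less_imp_le cat_in_Xs)
    have h: "continuous_on (Xs k) h"
      unfolding h_def by (rule continuous_on_word_indicator)
    have h_ind: "h x = of_real (indicator A x)" if "x \<in> Xs k" for x
      using that by (auto simp: h_def A)
    have ph: "p z *\<^sub>R h z = of_real (p z * indicator A z)" if "z \<in> Xs k" for z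
      by (simp add: h_ind[OF that] scaleR_conv_of_real)
    have LLh: "LL k p h x = of_real (r x)" if "x \<in> Xs k" for x
      unfolding LL_words[OF that] r_def of_real_sum by (intro sum.cong refl ph cat_in_Xs that)
    have "continuous_on (Xs k) (LL k p h)"
      using continuous_on_LL_funpow[OF p_cont h, of 1] by simp
    then have int: "integrable \<mu> (LL k p h)"
      by (rule integrable_continuous_Xs[OF prob_space_axioms mu_sets])
    have "integrable \<mu> (\<lambda>x. complex_of_real (r x))"
      using int by (rule Bochner_Integration.integrable_cong[THEN iffD1, rotated 2]) (auto simp: LLh space_mu)
    then have r_int: "integrable \<mu> r"
      by (simp add: complex_of_real_integrable_eq)
    have "complex_of_real (\<integral>x. r x \<partial>\<mu>) = (\<integral>x. LL k p h x \<partial>\<mu>)"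
      by (subst integral_complex_of_real[symmetric], rule Bochner_Integration.integral_cong) (auto simp: LLh space_mu)
    also have "\<dots> = (\<integral>x. h x \<partial>\<mu>)" by (rule mu_inv[OF h])
    also have "\<dots> = (\<integral>x. complex_of_real (indicator A x) \<partial>\<mu>)"
      by (rule Bochner_Integration.integral_cong) (auto simp: h_ind space_mu)
    also have "\<dots> = complex_of_real (measure \<mu> A)"
      using A_meas by (simp add: integral_complex_of_real del: of_real_indicator)
    finally have r: "(\<integral>x. r x \<partial>\<mu>) = measure \<mu> A" by simp
    have "(\<Sum>v\<in>words k 1. emeasure (branch v) A) = (\<integral>\<^sup>+x. ennreal (r x) \<partial>\<mu>)"
      unfolding em[OF A_meas] r_def
    proof (rule nn_integral_cong)
      fix x assume "x \<in> space \<mu>"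
      then have "p (cat 1 u x) \<ge> 0" if "u \<in> words k 1" for u
        using p_pos[OF cat_in_Xs[OF that]] by (auto simp: space_mu less_imp_le)
      then show "(\<Sum>u\<in>words k 1. ennreal (p (cat 1 u x)) * indicator A (cat 1 u x))
          = ennreal (\<Sum>u\<in>words k 1. p (cat 1 u x) * indicator A (cat 1 u x))"
        by (auto intro!: sum_ennreal)
    qed
    also have "\<dots> = ennreal (\<integral>x. r x \<partial>\<mu>)"
      using r_nonneg by (intro nn_integral_eq_integral[OF r_int] AE_I2) (simp add: space_mu)
    also have "\<dots> = emeasure \<mu> A"
      by (simp add: r emeasure_eq_measure)
    finally show ?thesis .
  qed
  have fin: "(\<Sum>v\<in>words k 1. emeasure (branch v) (Xs k)) = 1"
    using cyl[OF Xs_in_cylinders] emeasure_space_1 by (simp add: space_mu)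
  have sets_branch: "sets (branch v) = sets \<mu>" for v by (simp add: branch_def)
  have "insert {} (cylinders k) \<subseteq> Pow (Xs k)" using cylinders_subset by auto
  moreover have "A \<in> sigma_sets (Xs k) (insert {} (cylinders k))" using assms gen by simp
  ultimately show ?thesis
  proof (induction rule: sigma_sets_induct_disjoint[OF Int_stable_cylinders, consumes 2, case_names basic empty compl union])
    case (basic A) then show ?case using cyl by auto
  next
    case empty show ?case by simp
  next
    case (compl A)
    have A: "A \<in> sets \<mu>" "Xs k - A \<in> sets \<mu>" "A \<inter> (Xs k - A) = {}" "A \<union> (Xs k - A) = Xs k"
      using compl sets.sets_into_space[of A \<mu>] sets.compl_sets[of A \<mu>] by (auto simp: gen[symmetric] space_mu)
    \<comment> \<open>Complements are handled by adding the measure of \<open>A\<close> to both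
      sides, since subtraction is awkward in extended reals; finiteness permits cancelling
      afterwards.\<close>
    have "emeasure \<mu> A + (\<Sum>v\<in>words k 1. emeasure (branch v) (Xs k - A))
        = (\<Sum>v\<in>words k 1. emeasure (branch v) (Xs k))"
      using A by (simp add: compl(2)[symmetric] sum.distrib[symmetric] plus_emeasure sets_branch del: Un_Diff_cancel)
    also have "\<dots> = emeasure \<mu> A + emeasure \<mu> (Xs k - A)"
      using A emeasure_space_1 by (simp add: fin plus_emeasure space_mu del: Un_Diff_cancel)
    finally show ?case
      by (simp add: ennreal_add_left_cancel emeasure_eq_measure)
  next
    case (union A)
    have A: "range A \<subseteq> sets \<mu>" using union(2) by (auto simp: gen)
    have "(\<Sum>v\<in>words k 1. emeasure (branch v) (\<Union>i. A i)) = (\<Sum>v\<in>words k 1. \<Sum>i. emeasure (branch v) (A i))"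
      using A union(1) by (intro sum.cong refl suminf_emeasure[symmetric]) (auto simp: sets_branch)
    also have "\<dots> = (\<Sum>i. \<Sum>v\<in>words k 1. emeasure (branch v) (A i))"
      by (rule suminf_sum[symmetric]) auto
    also have "\<dots> = (\<Sum>i. emeasure \<mu> (A i))" using union(3) by simp
    also have "\<dots> = emeasure \<mu> (\<Union>i. A i)" by (rule suminf_emeasure[OF A union(1)])
    finally show ?case .
  qed
qed

lemma nn_integral_transfer:
  fixes f :: "pt \<Rightarrow> ennreal"
  assumes "f \<in> borel_measurable \<mu>"
  shows "(\<integral>\<^sup>+x. (\<Sum>v\<in>words k 1. ennreal (p (cat 1 v x)) * f (cat 1 v x)) \<partial>\<mu>) = (\<integral>\<^sup>+x. f x \<partial>\<mu>)"
proof -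
  have [simp]: "sets (branch v) = sets \<mu>" "space (branch v) = Xs k" for v
    by (auto simp: branch_def space_mu)
  have meas: "f \<in> borel_measurable (branch v)" if "f \<in> borel_measurable \<mu>" for v and f :: "pt \<Rightarrow> ennreal"
    using that by (simp cong: measurable_cong_sets)
  have "(\<Sum>v\<in>words k 1. \<integral>\<^sup>+x. f x \<partial>branch v) = (\<integral>\<^sup>+x. f x \<partial>\<mu>)"
    using assms
  proof (induction rule: borel_measurable_induct)
    case (cong f g)
    have "(\<integral>\<^sup>+x. f x \<partial>branch v) = (\<integral>\<^sup>+x. g x \<partial>branch v)" for v
      using cong(3) by (intro nn_integral_cong) (simp add: space_mu)
    moreover have "(\<integral>\<^sup>+x. f x \<partial>\<mu>) = (\<integral>\<^sup>+x. g x \<partial>\<mu>)"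
      using cong(3) by (rule nn_integral_cong)
    ultimately show ?case using cong(4) by simp
  next
    case (set A)
    then show ?case by (simp add: sum_emeasure_branch)
  next
    case (mult u c)
    then show ?case by (simp add: nn_integral_cmult meas sum_distrib_left[symmetric])
  next
    case (add u v)
    then show ?case by (simp add: nn_integral_add meas sum.distrib)
  next
    case (seq U)
    have "(\<integral>\<^sup>+x. (SUP i. U i) x \<partial>branch v) = (SUP i. \<integral>\<^sup>+x. U i x \<partial>branch v)" for v
      using seq by (simp add: image_comp nn_integral_monotone_convergence_SUP meas)
    moreover have "(\<integral>\<^sup>+x. (SUP i. U i) x \<partial>\<mu>) = (SUP i. \<integral>\<^sup>+x. U i x \<partial>\<mu>)"
      using seq by (simp add: image_comp nn_integral_monotone_convergence_SUP)
    moreover have "(\<Sum>v\<in>words k 1. SUP i. \<integral>\<^sup>+x. U i x \<partial>branch v) = (SUP i. \<Sum>v\<in>words k 1. \<integral>\<^sup>+x. U i x \<partial>branch v)"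
      using \<open>incseq U\<close>
      by (intro ennreal_SUP_sum[symmetric]) (auto simp: incseq_def le_fun_def intro!: nn_integral_mono)
    ultimately show ?case using seq.IH by simp
  qed
  moreover have "(\<lambda>x. ennreal (p (cat 1 v x)) * f (cat 1 v x)) \<in> borel_measurable \<mu>"
    if "v \<in> words k 1" for v
  proof -
    note [measurable] = measurable_cat[OF that] assms
    show ?thesis by measurable
  qed
  ultimately show ?thesis
    by (simp only: nn_integral_sum nn_integral_branch assms cong: sum.cong)
qed

text \<open>Transfer is applied to \<open>f\<close> composed with the shift. This is constant on
  each fibre, and the weights \<open>p\<close> of a fibre add up to 1.\<close>

lemma nn_integral_shift:
  fixes f :: "pt \<Rightarrow> ennreal"
  assumes [measurable]: "f \<in> borel_measurable \<mu>"
  shows "(\<integral>\<^sup>+x. f (shift x) \<partial>\<mu>) = (\<integral>\<^sup>+x. f x \<partial>\<mu>)"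
proof -
  have "(\<integral>\<^sup>+x. f (shift x) \<partial>\<mu>)
      = (\<integral>\<^sup>+x. (\<Sum>v\<in>words k 1. ennreal (p (cat 1 v x)) * f (shift (cat 1 v x))) \<partial>\<mu>)"
    by (rule nn_integral_transfer[symmetric]) measurable
  also have "\<dots> = (\<integral>\<^sup>+x. f x \<partial>\<mu>)"
  proof (rule nn_integral_cong)
    fix x assume x: "x \<in> space \<mu>"
    have "shift (cat 1 v x) = x" for v using shift_cat[of 1 v x] by simp
    then have "(\<Sum>v\<in>words k 1. ennreal (p (cat 1 v x)) * f (shift (cat 1 v x)))
        = (\<Sum>v\<in>words k 1. ennreal (p (cat 1 v x))) * f x"
      by (simp add: sum_distrib_right)
    also have "(\<Sum>v\<in>words k 1. ennreal (p (cat 1 v x))) = 1"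
      using x p_words[of x] p_pos by (subst sum_ennreal) (auto simp: space_mu cat_in_Xs less_imp_le)
    finally show "(\<Sum>v\<in>words k 1. ennreal (p (cat 1 v x)) * f (shift (cat 1 v x))) = f x" by simp
  qed
  finally show ?thesis .
qed

end

section \<open>Bounded operators on $L^2$ and analyticity of the flow\<close>

text \<open>Stronger than \<open>bounded_op\<close>: linearity is a pointwise identity on all
  functions. All concrete operators here satisfy it, and closure under composition and difference
  then needs no juggling of null sets.\<close>

definition bounded_linear_op :: "pt measure \<Rightarrow> op \<Rightarrow> bool" where
  "bounded_linear_op \<mu> A \<longleftrightarrow>
     (\<forall>\<xi>\<in>L2 \<mu>. A \<xi> \<in> L2 \<mu>) \<and>
     (\<forall>\<xi>\<in>L2 \<mu>. \<forall>\<eta>\<in>L2 \<mu>. (AE x in \<mu>. \<xi> x = \<eta> x) \<longrightarrow> (AE x in \<mu>. A \<xi> x = A \<eta> x)) \<and>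
     (\<forall>\<xi> \<eta> c. A (\<lambda>y. \<xi> y + c * \<eta> y) = (\<lambda>y. A \<xi> y + c * A \<eta> y)) \<and>
     (\<exists>C\<ge>0. \<forall>\<xi>\<in>L2 \<mu>. l2norm \<mu> (A \<xi>) \<le> C * l2norm \<mu> \<xi>)"

lemma bounded_linear_op_imp_bounded_op: "bounded_linear_op \<mu> A \<Longrightarrow> bounded_op \<mu> A"
  unfolding bounded_linear_op_def bounded_op_def by auto

lemma l2norm_nonneg: "l2norm \<mu> \<xi> \<ge> 0"
  by (simp add: l2norm_def integral_nonneg_AE)

lemma L2_iff: "\<xi> \<in> L2 \<mu> \<longleftrightarrow> \<xi> \<in> borel_measurable \<mu> \<and> (\<integral>\<^sup>+x. ennreal ((cmod (\<xi> x))\<^sup>2) \<partial>\<mu>) < \<infinity>"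
  by (auto simp: L2_def integrable_iff_bounded)

lemma l2norm_sq:
  assumes "\<xi> \<in> L2 \<mu>"
  shows "ennreal ((l2norm \<mu> \<xi>)\<^sup>2) = (\<integral>\<^sup>+x. ennreal ((cmod (\<xi> x))\<^sup>2) \<partial>\<mu>)"
  using assms by (simp add: L2_def l2norm_def nn_integral_eq_integral)

text \<open>Nonnegative integrals deliver membership and the norm bound at once, without
  integrability of the new function being known beforehand.\<close>

lemma L2_dominated:
  assumes \<xi>: "\<xi> \<in> borel_measurable \<mu>" and \<eta>: "\<eta> \<in> L2 \<mu>" and C: "C \<ge> 0"
    and le: "(\<integral>\<^sup>+x. ennreal ((cmod (\<xi> x))\<^sup>2) \<partial>\<mu>) \<le> ennreal (C\<^sup>2) * (\<integral>\<^sup>+x. ennreal ((cmod (\<eta> x))\<^sup>2) \<partial>\<mu>)"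
  shows "\<xi> \<in> L2 \<mu>" "l2norm \<mu> \<xi> \<le> C * l2norm \<mu> \<eta>"
proof -
  have "(\<integral>\<^sup>+x. ennreal ((cmod (\<xi> x))\<^sup>2) \<partial>\<mu>) < \<infinity>"
    using le \<eta> by (auto simp: L2_iff ennreal_mult_less_top intro: le_less_trans)
  with \<xi> show \<xi>2: "\<xi> \<in> L2 \<mu>" by (simp add: L2_iff)
  have "ennreal ((l2norm \<mu> \<xi>)\<^sup>2) \<le> ennreal ((C * l2norm \<mu> \<eta>)\<^sup>2)"
    using le C by (simp add: l2norm_sq[OF \<xi>2, symmetric] l2norm_sq[OF \<eta>, symmetric]
        ennreal_mult[symmetric] power_mult_distrib)
  then have "(l2norm \<mu> \<xi>)\<^sup>2 \<le> (C * l2norm \<mu> \<eta>)\<^sup>2"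
    by (subst (asm) ennreal_le_iff) auto
  then show "l2norm \<mu> \<xi> \<le> C * l2norm \<mu> \<eta>"
    by (rule power2_le_imp_le) (use C l2norm_nonneg in auto)
qed

lemma L2_pointwise_dominated:
  assumes \<xi>: "\<xi> \<in> borel_measurable \<mu>" and \<eta>: "\<eta> \<in> L2 \<mu>" and C: "C \<ge> 0"
    and le: "\<And>x. x \<in> space \<mu> \<Longrightarrow> cmod (\<xi> x) \<le> C * cmod (\<eta> x)"
  shows "\<xi> \<in> L2 \<mu>" "l2norm \<mu> \<xi> \<le> C * l2norm \<mu> \<eta>"
proof -
  have [measurable]: "\<eta> \<in> borel_measurable \<mu>" using \<eta> by (simp add: L2_iff)
  have "(\<integral>\<^sup>+x. ennreal ((cmod (\<xi> x))\<^sup>2) \<partial>\<mu>) \<le> (\<integral>\<^sup>+x. ennreal (C\<^sup>2) * ennreal ((cmod (\<eta> x))\<^sup>2) \<partial>\<mu>)"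
  proof (rule nn_integral_mono)
    fix x assume "x \<in> space \<mu>"
    then have "(cmod (\<xi> x))\<^sup>2 \<le> (C * cmod (\<eta> x))\<^sup>2"
      using le by (intro power_mono) auto
    then show "ennreal ((cmod (\<xi> x))\<^sup>2) \<le> ennreal (C\<^sup>2) * ennreal ((cmod (\<eta> x))\<^sup>2)"
      by (simp add: ennreal_mult[symmetric] power_mult_distrib ennreal_leI)
  qed
  also have "\<dots> = ennreal (C\<^sup>2) * (\<integral>\<^sup>+x. ennreal ((cmod (\<eta> x))\<^sup>2) \<partial>\<mu>)"
    by (rule nn_integral_cmult) measurable
  finally show "\<xi> \<in> L2 \<mu>" "l2norm \<mu> \<xi> \<le> C * l2norm \<mu> \<eta>"
    using L2_dominated[OF \<xi> \<eta> C] by auto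
qed

text \<open>The factor 2 is crude: it comes from bounding the square of a sum by twice the sum of
  squares. Only boundedness matters in its applications.\<close>

lemma L2_minus:
  assumes \<xi>: "\<xi> \<in> L2 \<mu>" and \<eta>: "\<eta> \<in> L2 \<mu>"
  shows "(\<lambda>x. \<xi> x - \<eta> x) \<in> L2 \<mu>"
    and "l2norm \<mu> (\<lambda>x. \<xi> x - \<eta> x) \<le> 2 * (l2norm \<mu> \<xi> + l2norm \<mu> \<eta>)"
proof -
  have [measurable]: "\<xi> \<in> borel_measurable \<mu>" "\<eta> \<in> borel_measurable \<mu>"
    using \<xi> \<eta> by (auto simp: L2_iff)
  have "(\<integral>\<^sup>+x. ennreal ((cmod (\<xi> x - \<eta> x))\<^sup>2) \<partial>\<mu>)
      \<le> (\<integral>\<^sup>+x. ennreal 2 * (ennreal ((cmod (\<xi> x))\<^sup>2) + ennreal ((cmod (\<eta> x))\<^sup>2)) \<partial>\<mu>)"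
  proof (rule nn_integral_mono)
    fix x
    have "(cmod (\<xi> x - \<eta> x))\<^sup>2 \<le> (cmod (\<xi> x) + cmod (\<eta> x))\<^sup>2"
      by (intro power_mono norm_triangle_ineq4) auto
    also have "\<dots> \<le> 2 * ((cmod (\<xi> x))\<^sup>2 + (cmod (\<eta> x))\<^sup>2)"
      using sum_squares_bound[of "cmod (\<xi> x)" "cmod (\<eta> x)"] by (simp add: power2_sum)
    finally show "ennreal ((cmod (\<xi> x - \<eta> x))\<^sup>2)
        \<le> ennreal 2 * (ennreal ((cmod (\<xi> x))\<^sup>2) + ennreal ((cmod (\<eta> x))\<^sup>2))"
      by (simp add: ennreal_mult[symmetric] ennreal_plus[symmetric] ennreal_leI del: ennreal_plus ennreal_numeral)
  qed
  also have "\<dots> = ennreal 2 * ((\<integral>\<^sup>+x. ennreal ((cmod (\<xi> x))\<^sup>2) \<partial>\<mu>) + (\<integral>\<^sup>+x. ennreal ((cmod (\<eta> x))\<^sup>2) \<partial>\<mu>))"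
    by (simp add: nn_integral_cmult nn_integral_add)
  also have "\<dots> = ennreal (2 * ((l2norm \<mu> \<xi>)\<^sup>2 + (l2norm \<mu> \<eta>)\<^sup>2))"
    by (simp add: l2norm_sq[OF \<xi>, symmetric] l2norm_sq[OF \<eta>, symmetric] ennreal_mult[symmetric]
        ennreal_plus[symmetric] del: ennreal_plus ennreal_numeral)
  finally have le: "(\<integral>\<^sup>+x. ennreal ((cmod (\<xi> x - \<eta> x))\<^sup>2) \<partial>\<mu>) \<le> ennreal (2 * ((l2norm \<mu> \<xi>)\<^sup>2 + (l2norm \<mu> \<eta>)\<^sup>2))" .
  then show L2: "(\<lambda>x. \<xi> x - \<eta> x) \<in> L2 \<mu>"
    by (auto simp: L2_iff intro: le_less_trans)
  have "(l2norm \<mu> (\<lambda>x. \<xi> x - \<eta> x))\<^sup>2 \<le> 2 * ((l2norm \<mu> \<xi>)\<^sup>2 + (l2norm \<mu> \<eta>)\<^sup>2)"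
    using le unfolding l2norm_sq[OF L2, symmetric] by (subst (asm) ennreal_le_iff) auto
  also have "\<dots> \<le> (2 * (l2norm \<mu> \<xi> + l2norm \<mu> \<eta>))\<^sup>2"
    using l2norm_nonneg[of \<mu> \<xi>] l2norm_nonneg[of \<mu> \<eta>] by (simp add: power2_eq_square algebra_simps)
  finally show "l2norm \<mu> (\<lambda>x. \<xi> x - \<eta> x) \<le> 2 * (l2norm \<mu> \<xi> + l2norm \<mu> \<eta>)"
    by (rule power2_le_imp_le) (use l2norm_nonneg[of \<mu> \<xi>] l2norm_nonneg[of \<mu> \<eta>] in auto)
qed

lemma bounded_linear_op_comp:
  assumes A: "bounded_linear_op \<mu> A" and B: "bounded_linear_op \<mu> B"
  shows "bounded_linear_op \<mu> (A \<circ> B)"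
proof -
  obtain C D where C: "C \<ge> 0" "\<And>\<xi>. \<xi> \<in> L2 \<mu> \<Longrightarrow> l2norm \<mu> (A \<xi>) \<le> C * l2norm \<mu> \<xi>"
    and D: "D \<ge> 0" "\<And>\<xi>. \<xi> \<in> L2 \<mu> \<Longrightarrow> l2norm \<mu> (B \<xi>) \<le> D * l2norm \<mu> \<xi>"
    using A B unfolding bounded_linear_op_def by metis
  have BL2: "B \<xi> \<in> L2 \<mu>" if "\<xi> \<in> L2 \<mu>" for \<xi>
    using B that unfolding bounded_linear_op_def by blast
  have "l2norm \<mu> (A (B \<xi>)) \<le> C * D * l2norm \<mu> \<xi>" if "\<xi> \<in> L2 \<mu>" for \<xi>
    using C(2)[OF BL2[OF that]] mult_left_mono[OF D(2)[OF that] C(1)] by (simp add: mult.assoc)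
  then have "\<exists>E\<ge>0. \<forall>\<xi>\<in>L2 \<mu>. l2norm \<mu> ((A \<circ> B) \<xi>) \<le> E * l2norm \<mu> \<xi>"
    using C(1) D(1) by (intro exI[of _ "C * D"]) auto
  then show ?thesis
    using A B unfolding bounded_linear_op_def by auto
qed

lemma bounded_linear_op_id: "bounded_linear_op \<mu> id"
  unfolding bounded_linear_op_def by (auto intro!: exI[of _ 1])

lemma bounded_linear_op_funpow: "bounded_linear_op \<mu> A \<Longrightarrow> bounded_linear_op \<mu> (A ^^ n)"
  by (induction n) (auto intro: bounded_linear_op_comp bounded_linear_op_id)

lemma bounded_linear_op_minus:
  assumes A: "bounded_linear_op \<mu> A" and B: "bounded_linear_op \<mu> B"
  shows "bounded_linear_op \<mu> (op_minus A B)"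
proof -
  obtain C D where C: "C \<ge> 0" "\<And>\<xi>. \<xi> \<in> L2 \<mu> \<Longrightarrow> l2norm \<mu> (A \<xi>) \<le> C * l2norm \<mu> \<xi>"
    and D: "D \<ge> 0" "\<And>\<xi>. \<xi> \<in> L2 \<mu> \<Longrightarrow> l2norm \<mu> (B \<xi>) \<le> D * l2norm \<mu> \<xi>"
    using A B unfolding bounded_linear_op_def by metis
  have L2: "A \<xi> \<in> L2 \<mu>" "B \<xi> \<in> L2 \<mu>" if "\<xi> \<in> L2 \<mu>" for \<xi>
    using A B that unfolding bounded_linear_op_def by blast+
  have "l2norm \<mu> (op_minus A B \<xi>) \<le> 2 * (C + D) * l2norm \<mu> \<xi>" if "\<xi> \<in> L2 \<mu>" for \<xi>
    using L2_minus(2)[OF L2[OF that]] C(2)[OF that] D(2)[OF that]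
    by (simp add: op_minus_def algebra_simps)
  then have bd: "\<exists>E\<ge>0. \<forall>\<xi>\<in>L2 \<mu>. l2norm \<mu> (op_minus A B \<xi>) \<le> E * l2norm \<mu> \<xi>"
    using C(1) D(1) by (intro exI[of _ "2 * (C + D)"]) auto
  have ae: "AE x in \<mu>. op_minus A B \<xi> x = op_minus A B \<eta> x"
    if "\<xi> \<in> L2 \<mu>" "\<eta> \<in> L2 \<mu>" "AE x in \<mu>. \<xi> x = \<eta> x" for \<xi> \<eta>
  proof -
    have "AE x in \<mu>. A \<xi> x = A \<eta> x" "AE x in \<mu>. B \<xi> x = B \<eta> x"
      using A B that unfolding bounded_linear_op_def by blast+
    then show ?thesis by (auto simp: op_minus_def)
  qed
  have lin: "A (\<lambda>y. \<xi> y + c * \<eta> y) = (\<lambda>y. A \<xi> y + c * A \<eta> y)" "B (\<lambda>y. \<xi> y + c * \<eta> y) = (\<lambda>y. B \<xi> y + c * B \<eta> y)" for \<xi> \<eta> c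
    using A B unfolding bounded_linear_op_def by blast+
  show ?thesis
    unfolding bounded_linear_op_def using bd ae
    by (auto simp: op_minus_def lin L2_minus(1) L2 algebra_simps)
qed

text \<open>As \<open>opnorm\<close> is a real supremum, it is meaningful only for a nonempty set
  bounded above; the zero function and \<open>C\<close> provide this.\<close>

lemma opnorm_bounds:
  assumes C: "C \<ge> 0" and le: "\<And>\<xi>. \<xi> \<in> L2 \<mu> \<Longrightarrow> l2norm \<mu> (A \<xi>) \<le> C * l2norm \<mu> \<xi>"
  shows "0 \<le> opnorm \<mu> A" "opnorm \<mu> A \<le> C"
proof -
  let ?S = "{l2norm \<mu> (A \<xi>) | \<xi>. \<xi> \<in> L2 \<mu> \<and> l2norm \<mu> \<xi> \<le> 1}"
  have ub: "y \<le> C" if y: "y \<in> ?S" for y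
  proof -
    obtain \<xi> where \<xi>: "y = l2norm \<mu> (A \<xi>)" "\<xi> \<in> L2 \<mu>" "l2norm \<mu> \<xi> \<le> 1"
      using y by blast
    have "y \<le> C * l2norm \<mu> \<xi>" using le \<xi> by simp
    also have "\<dots> \<le> C * 1" using \<xi>(3) C by (rule mult_left_mono)
    finally show ?thesis by simp
  qed
  have "l2norm \<mu> (A (\<lambda>_. 0)) \<in> ?S"
    by (intro CollectI exI[of _ "\<lambda>_. 0"]) (auto simp: L2_def l2norm_def)
  moreover from this have "l2norm \<mu> (A (\<lambda>_. 0)) \<le> opnorm \<mu> A"
    unfolding opnorm_def by (rule cSup_upper) (use ub in \<open>auto intro!: bdd_aboveI\<close>)
  ultimately show "0 \<le> opnorm \<mu> A" "opnorm \<mu> A \<le> C"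
    using l2norm_nonneg[of \<mu> "A (\<lambda>_. 0)"] ub unfolding opnorm_def by (auto intro!: cSup_least)
qed

lemma Sop_funpow: "(Sop ^^ n) \<xi> x = \<xi> ((shift ^^ n) x)"
  by (induction n arbitrary: x) (auto simp: Sop_def funpow_swap1)

lemma LL_linear: "LL k w (\<lambda>y. \<xi> y + c * \<eta> y) = (\<lambda>y. LL k w \<xi> y + c * LL k w \<eta> y)"
  for c :: complex
  by (auto simp: LL_def scaleR_add_right sum.distrib sum_distrib_left)

context gibbs_shift
begin

lemma bounded_linear_op_Mop:
  assumes f: "continuous_on (Xs k) f"
  shows "bounded_linear_op \<mu> (Mop f)"
proof -
  obtain K where K: "K > 0" "\<And>x. x \<in> Xs k \<Longrightarrow> cmod (f x) \<le> K"
    using continuous_on_Xs_bounded[OF f] by metis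
  have [measurable]: "f \<in> borel_measurable \<mu>"
    by (rule borel_measurable_continuous_Xs[OF mu_sets f])
  have "Mop f \<xi> \<in> L2 \<mu>" "l2norm \<mu> (Mop f \<xi>) \<le> K * l2norm \<mu> \<xi>" if "\<xi> \<in> L2 \<mu>" for \<xi>
  proof -
    have [measurable]: "\<xi> \<in> borel_measurable \<mu>" using that by (simp add: L2_def)
    have "Mop f \<xi> \<in> borel_measurable \<mu>" by (simp add: Mop_def)
    then show "Mop f \<xi> \<in> L2 \<mu>" "l2norm \<mu> (Mop f \<xi>) \<le> K * l2norm \<mu> \<xi>"
      using K by (auto intro!: L2_pointwise_dominated[OF _ that, where C = K] mult_right_mono
          simp: Mop_def norm_mult space_mu)
  qed
  then show ?thesis
    using K(1) unfolding bounded_linear_op_def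
    by (auto simp: Mop_def algebra_simps intro!: exI[of _ K])
qed

lemma Sop_L2:
  assumes "\<xi> \<in> L2 \<mu>"
  shows "Sop \<xi> \<in> L2 \<mu>" "l2norm \<mu> (Sop \<xi>) \<le> l2norm \<mu> \<xi>"
proof -
  have [measurable]: "\<xi> \<in> borel_measurable \<mu>" using assms by (simp add: L2_def)
  have "Sop \<xi> \<in> borel_measurable \<mu>" unfolding Sop_def comp_def by measurable
  moreover have "(\<integral>\<^sup>+x. ennreal ((cmod (Sop \<xi> x))\<^sup>2) \<partial>\<mu>) = (\<integral>\<^sup>+x. ennreal ((cmod (\<xi> x))\<^sup>2) \<partial>\<mu>)"
    unfolding Sop_def comp_def by (rule nn_integral_shift) measurable
  ultimately show "Sop \<xi> \<in> L2 \<mu>" "l2norm \<mu> (Sop \<xi>) \<le> l2norm \<mu> \<xi>"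
    using L2_dominated[of "Sop \<xi>" \<mu> \<xi> 1] assms by auto
qed

lemma AE_zero_iff_L2:
  assumes "f \<in> borel_measurable \<mu>"
  shows "(AE x in \<mu>. f x = 0) \<longleftrightarrow> (\<integral>\<^sup>+x. ennreal ((cmod (f x))\<^sup>2) \<partial>\<mu>) = 0"
  using assms by (subst nn_integral_0_iff_AE) (auto simp: ennreal_eq_0_iff)

text \<open>Compatibility with equality almost everywhere is automatic: the difference of two
  representatives has norm 0, and so has its image.\<close>

lemma bounded_linear_op_L2_contraction:
  assumes "\<And>\<xi>. \<xi> \<in> L2 \<mu> \<Longrightarrow> A \<xi> \<in> L2 \<mu>" "\<And>\<xi>. \<xi> \<in> L2 \<mu> \<Longrightarrow> l2norm \<mu> (A \<xi>) \<le> l2norm \<mu> \<xi>"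
    and lin: "\<And>\<xi> \<eta> c. A (\<lambda>y. \<xi> y + c * \<eta> y) = (\<lambda>y. A \<xi> y + c * A \<eta> y)"
  shows "bounded_linear_op \<mu> A"
proof -
  have "AE x in \<mu>. A \<xi> x = A \<eta> x"
    if L2: "\<xi> \<in> L2 \<mu>" "\<eta> \<in> L2 \<mu>" and ae: "AE x in \<mu>. \<xi> x = \<eta> x" for \<xi> \<eta>
  proof -
    let ?d = "\<lambda>x. \<xi> x - \<eta> x"
    have d: "?d \<in> L2 \<mu>" by (rule L2_minus[OF L2])
    then have "(\<integral>\<^sup>+x. ennreal ((cmod (?d x))\<^sup>2) \<partial>\<mu>) = 0"
      using ae by (subst AE_zero_iff_L2[symmetric]) (auto simp: L2_iff)
    then have "l2norm \<mu> ?d = 0"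
      unfolding l2norm_sq[OF d, symmetric] by (simp add: ennreal_eq_0_iff)
    then have "l2norm \<mu> (A ?d) = 0"
      using assms(2)[OF d] l2norm_nonneg[of \<mu> "A ?d"] by simp
    then have "AE x in \<mu>. A ?d x = 0"
      using assms(1)[OF d] l2norm_sq[OF assms(1)[OF d]] by (subst AE_zero_iff_L2) (auto simp: L2_iff)
    moreover have "A ?d x = A \<xi> x - A \<eta> x" for x
      using lin[of \<xi> "-1" \<eta>] by simp
    ultimately show ?thesis by auto
  qed
  then show ?thesis
    using assms unfolding bounded_linear_op_def by (auto intro!: exI[of _ 1])
qed

lemma bounded_linear_op_Sop: "bounded_linear_op \<mu> Sop"
  by (rule bounded_linear_op_L2_contraction) (auto simp: Sop_L2, simp add: Sop_def comp_def)

lemma Sadj_measurable: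
  assumes [measurable]: "\<xi> \<in> borel_measurable \<mu>"
  shows "Sadj k p \<xi> \<in> borel_measurable \<mu>"
proof -
  have "(\<lambda>x. \<Sum>v\<in>words k 1. p (cat 1 v x) *\<^sub>R \<xi> (cat 1 v x)) \<in> borel_measurable \<mu>"
  proof (intro borel_measurable_sum)
    fix v assume "v \<in> words k 1"
    note [measurable] = measurable_cat[OF this]
    show "(\<lambda>x. p (cat 1 v x) *\<^sub>R \<xi> (cat 1 v x)) \<in> borel_measurable \<mu>" by measurable
  qed
  then show ?thesis
    by (rule measurable_cong[THEN iffD1, rotated]) (simp add: Sadj_def LL_words space_mu)
qed

text \<open>At each point the operator is an average with weights \<open>p\<close>. Jensen's
  inequality bounds the square of the average by the average of squares, whose integral is
  preserved.\<close>

lemma Sadj_L2: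
  assumes "\<xi> \<in> L2 \<mu>"
  shows "Sadj k p \<xi> \<in> L2 \<mu>" "l2norm \<mu> (Sadj k p \<xi>) \<le> l2norm \<mu> \<xi>"
proof -
  have [measurable]: "\<xi> \<in> borel_measurable \<mu>" using assms by (simp add: L2_def)
  have "(\<integral>\<^sup>+x. ennreal ((cmod (Sadj k p \<xi> x))\<^sup>2) \<partial>\<mu>)
      \<le> (\<integral>\<^sup>+x. (\<Sum>v\<in>words k 1. ennreal (p (cat 1 v x)) * ennreal ((cmod (\<xi> (cat 1 v x)))\<^sup>2)) \<partial>\<mu>)"
  proof (rule nn_integral_mono)
    fix x assume "x \<in> space \<mu>"
    then have x: "x \<in> Xs k" by (simp add: space_mu)
    define q where "q v = p (cat 1 v x)" for v
    define a where "a v = cmod (\<xi> (cat 1 v x))" for v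
    define m where "m = (\<Sum>v\<in>words k 1. q v * a v)"
    have q: "q v \<ge> 0" if "v \<in> words k 1" for v
      using p_pos[OF cat_in_Xs[OF that x]] by (simp add: q_def less_imp_le)
    have q1: "(\<Sum>v\<in>words k 1. q v) = 1" using p_words[OF x] by (simp add: q_def)
    \<comment> \<open>Jensen for the square, as nonnegativity of a variance with mean
      \<open>m\<close>.\<close>
    have "0 \<le> (\<Sum>v\<in>words k 1. q v * (a v - m)\<^sup>2)"
      using q by (intro sum_nonneg) auto
    also have "\<dots> = (\<Sum>v\<in>words k 1. q v * (a v)\<^sup>2 - 2 * m * (q v * a v) + m\<^sup>2 * q v)"
      by (intro sum.cong refl) (simp add: power2_eq_square algebra_simps)
    also have "\<dots> = (\<Sum>v\<in>words k 1. q v * (a v)\<^sup>2) - m\<^sup>2"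
      by (simp only: sum.distrib sum_subtractf sum_distrib_left[symmetric] q1 m_def[symmetric])
         (simp add: power2_eq_square)
    finally have var: "m\<^sup>2 \<le> (\<Sum>v\<in>words k 1. q v * (a v)\<^sup>2)" by simp
    have "cmod (Sadj k p \<xi> x) \<le> (\<Sum>v\<in>words k 1. cmod (q v *\<^sub>R \<xi> (cat 1 v x)))"
      unfolding Sadj_def LL_words[OF x] q_def by (rule norm_sum)
    also have "\<dots> = m"
      unfolding m_def a_def using q by (intro sum.cong) auto
    finally have "(cmod (Sadj k p \<xi> x))\<^sup>2 \<le> m\<^sup>2" by (intro power_mono) auto
    also note var
    finally have "ennreal ((cmod (Sadj k p \<xi> x))\<^sup>2) \<le> ennreal (\<Sum>v\<in>words k 1. q v * (a v)\<^sup>2)"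
      by (rule ennreal_leI)
    also have "\<dots> = (\<Sum>v\<in>words k 1. ennreal (q v) * ennreal ((a v)\<^sup>2))"
      using q by (subst sum_ennreal[symmetric]) (auto simp: ennreal_mult intro!: sum.cong)
    finally show "ennreal ((cmod (Sadj k p \<xi> x))\<^sup>2)
        \<le> (\<Sum>v\<in>words k 1. ennreal (p (cat 1 v x)) * ennreal ((cmod (\<xi> (cat 1 v x)))\<^sup>2))"
      by (simp add: q_def a_def)
  qed
  also have "\<dots> = (\<integral>\<^sup>+x. ennreal ((cmod (\<xi> x))\<^sup>2) \<partial>\<mu>)"
    by (rule nn_integral_transfer) measurable
  finally show "Sadj k p \<xi> \<in> L2 \<mu>" "l2norm \<mu> (Sadj k p \<xi>) \<le> l2norm \<mu> \<xi>"
    using L2_dominated[of "Sadj k p \<xi>" \<mu> \<xi> 1] assms Sadj_measurable by auto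
qed

lemma bounded_linear_op_Sadj: "bounded_linear_op \<mu> (Sadj k p)"
  by (rule bounded_linear_op_L2_contraction) (auto simp: Sadj_L2, simp add: Sadj_def LL_linear)

lemma bounded_linear_op_eop: "bounded_linear_op \<mu> (eop k p n)"
  unfolding eop_def
  by (intro bounded_linear_op_comp bounded_linear_op_funpow bounded_linear_op_Sop bounded_linear_op_Sadj)

lemma eop_L2:
  assumes "\<xi> \<in> L2 \<mu>"
  shows "eop k p n \<xi> \<in> L2 \<mu>" "l2norm \<mu> (eop k p n \<xi>) \<le> l2norm \<mu> \<xi>"
proof -
  have A: "(Sadj k p ^^ n) \<xi> \<in> L2 \<mu> \<and> l2norm \<mu> ((Sadj k p ^^ n) \<xi>) \<le> l2norm \<mu> \<xi>" for n
    by (induction n) (auto simp: assms Sadj_L2 intro: order_trans[OF Sadj_L2(2)])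
  have "(Sop ^^ m) ((Sadj k p ^^ n) \<xi>) \<in> L2 \<mu> \<and> l2norm \<mu> ((Sop ^^ m) ((Sadj k p ^^ n) \<xi>)) \<le> l2norm \<mu> \<xi>" for m
    by (induction m) (auto simp: A Sop_L2 intro: order_trans[OF Sop_L2(2)])
  then show "eop k p n \<xi> \<in> L2 \<mu>" "l2norm \<mu> (eop k p n \<xi>) \<le> l2norm \<mu> \<xi>"
    by (auto simp: eop_def)
qed

lemma bounded_linear_op_genop:
  "continuous_on (Xs k) f \<Longrightarrow> continuous_on (Xs k) g \<Longrightarrow> bounded_linear_op \<mu> (genop k p f n g)"
  unfolding genop_def by (intro bounded_linear_op_comp bounded_linear_op_Mop bounded_linear_op_eop)

lemma eop_words:
  assumes "x \<in> Xs k"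
  shows "eop k p n \<xi> x = (\<Sum>v\<in>words k n. lam_inv p n (cat n v ((shift ^^ n) x)) *\<^sub>R \<xi> (cat n v ((shift ^^ n) x)))"
  by (simp add: eop_def Sop_funpow Sadj_def LL_funpow[OF shift_in_Xs[OF assms]])

text \<open>The sum in the hypothesis is \<open>eop k p n\<close> applied to the absolute value of
  \<xi>, and \<open>eop\<close> is a contraction. A pointwise kernel bound thus becomes a norm bound
  with the same constant.\<close>

lemma l2norm_kernel_bound:
  assumes \<zeta>: "\<zeta> \<in> borel_measurable \<mu>" and \<xi>: "\<xi> \<in> L2 \<mu>" and C: "C \<ge> 0"
    and le: "\<And>x. x \<in> Xs k \<Longrightarrow> cmod (\<zeta> x) \<le> C * (\<Sum>v\<in>words k n.
       lam_inv p n (cat n v ((shift ^^ n) x)) * cmod (\<xi> (cat n v ((shift ^^ n) x))))"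
  shows "l2norm \<mu> \<zeta> \<le> C * l2norm \<mu> \<xi>"
proof -
  let ?a = "\<lambda>x. complex_of_real (cmod (\<xi> x))"
  have [measurable]: "\<xi> \<in> borel_measurable \<mu>" using \<xi> by (simp add: L2_def)
  have a: "?a \<in> L2 \<mu>" using \<xi> by (simp add: L2_def)
  have "l2norm \<mu> \<zeta> \<le> C * l2norm \<mu> (eop k p n ?a)"
  proof (rule L2_pointwise_dominated(2)[OF \<zeta> eop_L2(1)[OF a] C])
    fix x assume "x \<in> space \<mu>"
    then have x: "x \<in> Xs k" by (simp add: space_mu)
    have "eop k p n ?a x = complex_of_real (\<Sum>v\<in>words k n.
       lam_inv p n (cat n v ((shift ^^ n) x)) * cmod (\<xi> (cat n v ((shift ^^ n) x))))"
      by (simp add: eop_words[OF x] scaleR_conv_of_real)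
    then have "cmod (eop k p n ?a x) = \<bar>\<Sum>v\<in>words k n.
       lam_inv p n (cat n v ((shift ^^ n) x)) * cmod (\<xi> (cat n v ((shift ^^ n) x)))\<bar>"
      by (simp only: norm_of_real)
    then show "cmod (\<zeta> x) \<le> C * cmod (eop k p n ?a x)"
      using order_trans[OF le[OF x] mult_left_mono[OF abs_ge_self C]] by (simp only:)
  qed
  also have "\<dots> \<le> C * l2norm \<mu> ?a"
    using C by (intro mult_left_mono eop_L2(2) a)
  also have "l2norm \<mu> ?a = l2norm \<mu> \<xi>" by (simp add: l2norm_def)
  finally show ?thesis .
qed

section \<open>Entire extension of the flow on the averaging operators\<close>

text \<open>For \<open>u\<close> the Birkhoff sum of \<open>ln H\<close> and real \<open>z\<close>
  this is the image of \<open>e_n\<close> under the flow. On the fibre of \<open>x\<close> its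
  kernel is that of \<open>e_n\<close> times \<open>exp (\<i> * z * (u x - u y))\<close>, which is
  entire in \<open>z\<close>.\<close>

definition flow_e :: "nat \<Rightarrow> (pt \<Rightarrow> real) \<Rightarrow> complex \<Rightarrow> op" where
  "flow_e n u z = genop k p (\<lambda>x. exp (\<i> * z * of_real (u x))) n (\<lambda>x. exp (- \<i> * z * of_real (u x)))"

lemma bounded_linear_op_flow_e:
  assumes "continuous_on (Xs k) u"
  shows "bounded_linear_op \<mu> (flow_e n u z)"
  unfolding flow_e_def by (intro bounded_linear_op_genop continuous_intros assms)

text \<open>Factoring out \<open>exp (\<i> * z * d)\<close> leaves the second-order Taylor remainder
  of the exponential at \<open>w = \<i> * h * d\<close>. The bound is uniform over
  \<open>\<bar>d\<bar> \<le> R\<close>, as needed for all kernel entries at once.\<close>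

lemma exp_quotient_bound:
  fixes z h :: complex and d R :: real
  assumes h: "h \<noteq> 0" "cmod h \<le> 1" and d: "\<bar>d\<bar> \<le> R"
  shows "cmod ((exp (\<i> * (z + h) * d) - exp (\<i> * z * d)) / h - \<i> * d * exp (\<i> * z * d))
    \<le> exp (cmod z * R + R) * R\<^sup>2 * cmod h"
proof -
  define w where "w = \<i> * h * d"
  have w: "cmod w \<le> cmod h * R" using d by (simp add: w_def norm_mult mult_left_mono)
  have wR: "cmod w \<le> R"
    using w mult_right_mono[OF h(2), of R] d by linarith
  have "cmod (exp w - (\<Sum>j\<le>1. w ^ j / fact j)) \<le> exp \<bar>Re w\<bar> * cmod w ^ Suc 1 / fact 1"
    by (rule Taylor_exp)
  then have "cmod (exp w - 1 - w) \<le> exp \<bar>Re w\<bar> * (cmod w)\<^sup>2"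
    by (simp add: power2_eq_square One_nat_def algebra_simps)
  also have "\<dots> \<le> exp R * (cmod h * R)\<^sup>2"
    using wR w abs_Re_le_cmod[of w] by (intro mult_mono power_mono) auto
  finally have T: "cmod (exp w - 1 - w) \<le> exp R * (cmod h * R)\<^sup>2" .
  have "(exp (\<i> * (z + h) * d) - exp (\<i> * z * d)) / h - \<i> * d * exp (\<i> * z * d)
      = exp (\<i> * z * d) * (exp w - 1 - w) / h"
    using h(1) by (simp add: w_def exp_add field_simps)
  then have "cmod ((exp (\<i> * (z + h) * d) - exp (\<i> * z * d)) / h - \<i> * d * exp (\<i> * z * d))
      = cmod (exp (\<i> * z * d)) * cmod (exp w - 1 - w) / cmod h"
    by (simp add: norm_mult norm_divide)
  also have "\<dots> \<le> exp (cmod z * R) * (exp R * (cmod h * R)\<^sup>2) / cmod h"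
  proof (intro divide_right_mono mult_mono T)
    have "cmod (exp (\<i> * z * d)) \<le> exp (cmod (\<i> * z * d))" by (rule norm_exp)
    also have "\<dots> \<le> exp (cmod z * R)" using d by (simp add: norm_mult mult_left_mono)
    finally show "cmod (exp (\<i> * z * d)) \<le> exp (cmod z * R)" .
  qed auto
  also have "\<dots> = exp (cmod z * R + R) * R\<^sup>2 * cmod h"
    using h(1) by (simp add: exp_add power2_eq_square)
  finally show ?thesis .
qed

lemma genop_words:
  fixes f g \<xi> :: "pt \<Rightarrow> complex"
  assumes "x \<in> Xs k"
  shows "genop k p f n g \<xi> x = (\<Sum>v\<in>words k n. lam_inv p n (cat n v ((shift ^^ n) x)) *
    (f x * g (cat n v ((shift ^^ n) x))) * \<xi> (cat n v ((shift ^^ n) x)))"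
  by (simp add: genop_def Mop_def eop_words[OF assms] sum_distrib_left scaleR_conv_of_real mult_ac)

text \<open>Each kernel entry is differentiable in \<open>z\<close> with a uniform error of order
  \<open>cmod h\<close>, because \<open>u x - u y\<close> is bounded on the compact space.
  \<open>l2norm_kernel_bound\<close> turns this into convergence in operator norm.\<close>

lemma entire_ext_flow_e:
  assumes u: "continuous_on (Xs k) u"
    and eq: "\<And>t. op_eq \<mu> (flow_e n u (complex_of_real t)) (\<sigma> t a)"
  shows "entire_ext \<mu> \<sigma> a (flow_e n u)"
  unfolding entire_ext_def
proof (intro conjI allI eq)
  show "bounded_op \<mu> (flow_e n u z)" for z
    by (intro bounded_linear_op_imp_bounded_op bounded_linear_op_flow_e u)
next
  fix z
  define iu where "iu x = \<i> * complex_of_real (u x)" for x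
  \<comment> \<open>The derivative is a commutator: its kernel is that of
    \<open>flow_e n u z\<close> times \<open>\<i> * (u x - u y)\<close>.\<close>
  define D where "D = op_minus (Mop iu \<circ> flow_e n u z) (flow_e n u z \<circ> Mop iu)"
  have iu: "continuous_on (Xs k) iu" unfolding iu_def by (intro continuous_intros u)
  have D: "bounded_linear_op \<mu> D"
    unfolding D_def
    by (intro bounded_linear_op_minus bounded_linear_op_comp bounded_linear_op_flow_e bounded_linear_op_Mop u iu)
  obtain K where K: "K > 0" "\<And>x. x \<in> Xs k \<Longrightarrow> \<bar>u x\<bar> \<le> K"
    using continuous_on_Xs_bounded[OF u] by auto
  define C where "C = exp (cmod z * (2 * K) + 2 * K) * (2 * K)\<^sup>2"
  define T where "T h = op_minus (op_scale (1 / h) (op_minus (flow_e n u (z + h)) (flow_e n u z))) D" for h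
  have T: "0 \<le> opnorm \<mu> (T h) \<and> opnorm \<mu> (T h) \<le> C * cmod h" if h: "h \<noteq> 0" "cmod h \<le> 1" for h
  proof -
    have "l2norm \<mu> (T h \<xi>) \<le> C * cmod h * l2norm \<mu> \<xi>" if \<xi>: "\<xi> \<in> L2 \<mu>" for \<xi>
    proof (rule l2norm_kernel_bound[OF _ \<xi>, of _ _ n])
      have [measurable]: "flow_e n u w \<xi> \<in> borel_measurable \<mu>" for w
        using bounded_linear_op_flow_e[OF u, of n w] \<xi> by (auto simp: bounded_linear_op_def L2_def)
      have [measurable]: "D \<xi> \<in> borel_measurable \<mu>"
        using D \<xi> by (auto simp: bounded_linear_op_def L2_def)
      show "T h \<xi> \<in> borel_measurable \<mu>"
        unfolding T_def op_minus_def op_scale_def by measurable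
      show "C * cmod h \<ge> 0" by (simp add: C_def)
      fix x assume x: "x \<in> Xs k"
      define y where "y v = cat n v ((shift ^^ n) x)" for v
      define d where "d v = u x - u (y v)" for v
      have y: "y v \<in> Xs k" if "v \<in> words k n" for v
        unfolding y_def by (intro cat_in_Xs that shift_in_Xs x)
      define \<kappa> where "\<kappa> d = (exp (\<i> * (z + h) * complex_of_real d) - exp (\<i> * z * d)) / h - \<i> * d * exp (\<i> * z * d)" for d
      have flow: "flow_e n u w \<eta> x = (\<Sum>v\<in>words k n. lam_inv p n (y v) * exp (\<i> * w * d v) * \<eta> (y v))" for w \<eta>
      proof -
        have "flow_e n u w \<eta> x = (\<Sum>v\<in>words k n. lam_inv p n (y v) *
            (exp (\<i> * w * of_real (u x)) * exp (- \<i> * w * of_real (u (y v)))) * \<eta> (y v))"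
          unfolding flow_e_def y_def by (rule genop_words[OF x])
        then show ?thesis
          unfolding exp_add[symmetric] by (simp add: d_def algebra_simps)
      qed
      have "T h \<xi> x = (\<Sum>v\<in>words k n. lam_inv p n (y v) * \<kappa> (d v) * \<xi> (y v))"
        by (simp add: T_def op_minus_def op_scale_def D_def Mop_def flow iu_def \<kappa>_def
            sum_distrib_left sum_subtractf[symmetric] sum_divide_distrib)
           (intro sum.cong refl, simp add: d_def algebra_simps diff_divide_distrib)
      also have "cmod \<dots> \<le> (\<Sum>v\<in>words k n. C * cmod h * (lam_inv p n (y v) * cmod (\<xi> (y v))))"
      proof (rule sum_norm_le)
        fix v assume v: "v \<in> words k n"
        have "\<bar>d v\<bar> \<le> 2 * K"
          unfolding d_def using K(2)[OF x] K(2)[OF y[OF v]] by linarith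
        then have "cmod (\<kappa> (d v)) \<le> C * cmod h"
          unfolding \<kappa>_def C_def by (rule exp_quotient_bound[OF h])
        moreover have "lam_inv p n (y v) \<ge> 0"
          using lam_inv_pos[OF p_pos y[OF v]] by (simp add: less_imp_le)
        ultimately have "cmod (\<kappa> (d v)) * (lam_inv p n (y v) * cmod (\<xi> (y v)))
            \<le> C * cmod h * (lam_inv p n (y v) * cmod (\<xi> (y v)))"
          by (intro mult_right_mono) auto
        then show "cmod (lam_inv p n (y v) * \<kappa> (d v) * \<xi> (y v)) \<le> C * cmod h * (lam_inv p n (y v) * cmod (\<xi> (y v)))"
          using \<open>lam_inv p n (y v) \<ge> 0\<close> by (simp add: norm_mult mult_ac)
      qed
      finally show "cmod (T h \<xi> x) \<le> C * cmod h * (\<Sum>v\<in>words k n.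
          lam_inv p n (cat n v ((shift ^^ n) x)) * cmod (\<xi> (cat n v ((shift ^^ n) x))))"
        by (simp add: y_def sum_distrib_left)
    qed
    then show ?thesis
      using opnorm_bounds[of "C * cmod h" \<mu> "T h"] by (auto simp: C_def)
  qed
  have ev: "eventually (\<lambda>h. h \<noteq> 0 \<and> cmod h \<le> 1) (at 0)"
    unfolding eventually_at by (intro exI[of _ 1]) auto
  have "((\<lambda>h. opnorm \<mu> (T h)) \<longlongrightarrow> 0) (at 0)"
  proof (rule tendsto_sandwich)
    show "eventually (\<lambda>h. 0 \<le> opnorm \<mu> (T h)) (at 0)"
      using ev by eventually_elim (use T in blast)
    show "eventually (\<lambda>h. opnorm \<mu> (T h) \<le> C * cmod h) (at 0)"
      using ev by eventually_elim (use T in blast)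
    show "((\<lambda>h. C * cmod h) \<longlongrightarrow> 0) (at 0)"
      by (auto intro!: tendsto_eq_intros)
  qed auto
  then show "\<exists>D. bounded_op \<mu> D \<and> ((\<lambda>h. opnorm \<mu>
      (op_minus (op_scale (1 / h) (op_minus (flow_e n u (z + h)) (flow_e n u z))) D)) \<longlongrightarrow> 0) (at 0)"
    unfolding T_def using bounded_linear_op_imp_bounded_op[OF D] by blast
qed

lemma entire_ext_const:
  assumes B: "bounded_linear_op \<mu> B" and eq: "\<And>t. op_eq \<mu> B (\<sigma> t a)"
  shows "entire_ext \<mu> \<sigma> a (\<lambda>_. B)"
proof -
  \<comment> \<open>The zero operator, written as a difference so that its boundedness is already
    available.\<close>
  let ?Z = "op_minus B B"
  have "opnorm \<mu> (op_minus (op_scale (1 / h) (op_minus B B)) ?Z) = 0" for h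
    using opnorm_bounds[of 0 \<mu> "op_minus (op_scale (1 / h) (op_minus B B)) ?Z"]
    by (auto simp: op_minus_def op_scale_def l2norm_def)
  then show ?thesis
    unfolding entire_ext_def
    using B eq bounded_linear_op_minus[OF B B]
    by (auto intro!: exI[of _ ?Z] bounded_linear_op_imp_bounded_op)
qed

end

section \<open>KMS states\<close>

lemma genop_0: "genop k p f 0 g = Mop (\<lambda>x. f x * g x)"
  by (simp add: genop_def eop_def Mop_def fun_eq_iff mult.assoc)

lemma Mop_comp_genop: "Mop f \<circ> genop k p h n g = genop k p (\<lambda>x. f x * h x) n g"
  by (simp add: genop_def Mop_def fun_eq_iff mult.assoc)

lemma genop_comp_Mop: "genop k p h n g \<circ> Mop f = genop k p h n (\<lambda>x. g x * f x)"
  by (simp add: genop_def Mop_def fun_eq_iff mult.assoc)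

lemma Mop_one: "Mop (\<lambda>_. 1) = id"
  by (simp add: Mop_def fun_eq_iff)

lemma Mop_Sop_funpow: "((Mop h \<circ> Sop) ^^ n) \<xi> x = (\<Prod>j<n. h ((shift ^^ j) x)) * \<xi> ((shift ^^ n) x)"
proof (induction n arbitrary: x)
  case (Suc n)
  have "((Mop h \<circ> Sop) ^^ Suc n) \<xi> x = h x * ((Mop h \<circ> Sop) ^^ n) \<xi> (shift x)"
    by (simp only: funpow.simps comp_apply Mop_def Sop_def)
  also have "\<dots> = (\<Prod>j<Suc n. h ((shift ^^ j) x)) * \<xi> ((shift ^^ Suc n) x)"
    unfolding Suc by (simp add: prod.lessThan_Suc_shift funpow_swap1 mult.assoc del: prod.lessThan_Suc)
  finally show ?case .
qed simp

text \<open>A factor evaluated at \<open>z\<close> may be pulled inside \<open>Sadj\<close> once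
  composed with the shift. With \<open>Mop_Sop_funpow\<close> this brings the expression in
  \<open>sigma_gen\<close> into the form of \<open>flow_e\<close>.\<close>

lemma Sadj_Mop_funpow:
  "((Sadj k p \<circ> Mop h) ^^ n) \<xi> = (Sadj k p ^^ n) (\<lambda>z. (\<Prod>j<n. h ((shift ^^ j) z)) * \<xi> z)"
proof (induction n arbitrary: \<xi>)
  case (Suc n)
  have pull: "(\<Prod>j<n. h ((shift ^^ j) z)) * Sadj k p (Mop h \<xi>) z
      = Sadj k p (\<lambda>z. (\<Prod>j<Suc n. h ((shift ^^ j) z)) * \<xi> z) z" for z
    by (auto simp: Sadj_def LL_def Mop_def sum_distrib_left prod.lessThan_Suc_shift funpow_swap1
        mult_ac simp del: prod.lessThan_Suc intro!: sum.cong)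
  have "((Sadj k p \<circ> Mop h) ^^ Suc n) \<xi> = ((Sadj k p \<circ> Mop h) ^^ n) (Sadj k p (Mop h \<xi>))"
    by (simp only: funpow_Suc_right comp_apply)
  also have "\<dots> = (Sadj k p ^^ n) (Sadj k p (\<lambda>z. (\<Prod>j<Suc n. h ((shift ^^ j) z)) * \<xi> z))"
    unfolding Suc pull ..
  also have "\<dots> = (Sadj k p ^^ Suc n) (\<lambda>z. (\<Prod>j<Suc n. h ((shift ^^ j) z)) * \<xi> z)"
    by (simp only: funpow_Suc_right comp_apply)
  finally show ?case .
qed simp

lemma is_adjoint_Mop_real: "is_adjoint \<mu> (Mop (\<lambda>x. complex_of_real (s x))) (Mop (\<lambda>x. complex_of_real (s x)))"
  by (auto simp: is_adjoint_def inner2_def Mop_def mult_ac)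

text \<open>Integrating the two inequalities turns every iterate into a factor
  \<open>lam ^ n\<close>, which can be divided out once it is positive.\<close>

lemma eigenmeasure_bounds:
  fixes f w :: "pt \<Rightarrow> real" and lam :: real
  assumes nu: "prob_space \<nu>" "sets \<nu> = sets (borelX k)"
    and eig: "\<And>f :: pt \<Rightarrow> real. continuous_on (Xs k) f \<Longrightarrow> integral\<^sup>L \<nu> (LL k w f) = lam * integral\<^sup>L \<nu> f"
    and w: "continuous_on (Xs k) w" "\<And>x. x \<in> Xs k \<Longrightarrow> w x > 0"
    and f: "continuous_on (Xs k) f"
    and ab: "\<And>x. x \<in> Xs k \<Longrightarrow> a * (LL k w ^^ n) (\<lambda>_. 1) x \<le> (LL k w ^^ n) f x"
      "\<And>x. x \<in> Xs k \<Longrightarrow> (LL k w ^^ n) f x \<le> b * (LL k w ^^ n) (\<lambda>_. 1) x"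
  shows "a \<le> (\<integral>x. f x \<partial>\<nu>)" "(\<integral>x. f x \<partial>\<nu>) \<le> b"
proof -
  interpret nu: prob_space \<nu> by fact
  have sp: "space \<nu> = Xs k" by (rule space_borelX[OF nu(2)])
  have cont: "continuous_on (Xs k) ((LL k w ^^ n) g)" if "continuous_on (Xs k) g" for g :: "pt \<Rightarrow> real" and n
    by (rule continuous_on_LL_funpow[OF w(1) that])
  have int: "integrable \<nu> g" if "continuous_on (Xs k) g" for g :: "pt \<Rightarrow> real"
    by (rule integrable_continuous_Xs[OF nu that])
  have eign: "integral\<^sup>L \<nu> ((LL k w ^^ n) g) = lam ^ n * integral\<^sup>L \<nu> g"
    if "continuous_on (Xs k) g" for g :: "pt \<Rightarrow> real" and n
    by (induction n) (simp_all add: eig cont that)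
  have one: "continuous_on (Xs k) (\<lambda>_. 1 :: real)" by simp
  \<comment> \<open>The eigenvalue is the integral of \<open>LL k w\<close> applied to 1, a
    continuous function with positive minimum.\<close>
  have "lam > 0"
  proof -
    have ne: "Xs k \<noteq> {}" using nu.not_empty sp by simp
    obtain x0 where x0: "x0 \<in> Xs k" "\<And>x. x \<in> Xs k \<Longrightarrow> (LL k w ^^ 1) (\<lambda>_. 1 :: real) x0 \<le> (LL k w ^^ 1) (\<lambda>_. 1) x"
      using continuous_attains_inf[OF compact_Xs ne cont[OF one, of 1]] by blast
    have "0 < (LL k w ^^ 1) (\<lambda>_. 1 :: real) x0"
      by (rule LL_funpow_pos[OF w(2) _ x0(1)]) auto
    also have "\<dots> = (\<integral>x. (LL k w ^^ 1) (\<lambda>_. 1 :: real) x0 \<partial>\<nu>)"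
      by (simp add: nu.prob_space)
    also have "\<dots> \<le> (\<integral>x. (LL k w ^^ 1) (\<lambda>_. 1 :: real) x \<partial>\<nu>)"
      using x0(2) by (intro integral_mono int cont one) (auto simp: sp)
    also have "\<dots> = lam"
      using eign[OF one, of 1] nu.prob_space by simp
    finally show ?thesis .
  qed
  then have pos: "lam ^ n > 0" by simp
  have "(\<integral>x. a * (LL k w ^^ n) (\<lambda>_. 1) x \<partial>\<nu>) \<le> (\<integral>x. (LL k w ^^ n) f x \<partial>\<nu>)"
    by (intro integral_mono integrable_mult_right int cont one f) (simp add: sp ab)
  then have "a * lam ^ n \<le> lam ^ n * (\<integral>x. f x \<partial>\<nu>)"
    by (simp add: eign f nu.prob_space)
  with pos show "a \<le> (\<integral>x. f x \<partial>\<nu>)" by (simp add: mult.commute)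
  have "(\<integral>x. (LL k w ^^ n) f x \<partial>\<nu>) \<le> (\<integral>x. b * (LL k w ^^ n) (\<lambda>_. 1) x \<partial>\<nu>)"
    by (intro integral_mono integrable_mult_right int cont one f) (simp add: sp ab)
  then have "lam ^ n * (\<integral>x. f x \<partial>\<nu>) \<le> b * lam ^ n"
    by (simp add: eign f nu.prob_space)
  with pos show "(\<integral>x. f x \<partial>\<nu>) \<le> b" by (simp add: mult.commute)
qed

locale kms_gibbs_shift = gibbs_shift +
  fixes H :: "pt \<Rightarrow> real" and \<beta> :: real and \<sigma> :: "real \<Rightarrow> op \<Rightarrow> op" and \<psi> :: "op \<Rightarrow> complex"
  assumes H_cont: "continuous_on (Xs k) H" and H_pos: "\<And>x. x \<in> Xs k \<Longrightarrow> H x > 0"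
    and sigma_gen: "\<And>t f g n. continuous_on (Xs k) f \<Longrightarrow> continuous_on (Xs k) g \<Longrightarrow>
          op_eq \<mu> (\<sigma> t (genop k p f n g))
            (Mop f \<circ> ((Mop (\<lambda>x. exp (\<i> * complex_of_real t * complex_of_real (ln (H x)))) \<circ> Sop) ^^ n)
                   \<circ> ((Sadj k p \<circ> Mop (\<lambda>x. cnj (exp (\<i> * complex_of_real t * complex_of_real (ln (H x)))))) ^^ n)
                   \<circ> Mop g)"
    and KMS: "is_KMS \<mu> (Ualg k p \<mu>) \<sigma> \<beta> \<psi>"
begin

abbreviation U :: "op set" where "U \<equiv> Ualg k p \<mu>"

definition \<rho> :: "(pt \<Rightarrow> complex) \<Rightarrow> complex" where
  "\<rho> f = \<psi> (Mop f)"

lemma genop_in_U: "continuous_on (Xs k) f \<Longrightarrow> continuous_on (Xs k) g \<Longrightarrow> genop k p f n g \<in> U"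
  by (intro Ualg.gen) (simp_all add: contX_iff_continuous_on)

lemma Mop_in_U: "continuous_on (Xs k) f \<Longrightarrow> Mop f \<in> U"
  using genop_in_U[of f "\<lambda>_. 1" 0] by (simp add: genop_0)

lemma state: "is_state \<mu> U \<psi>"
  using KMS by (simp add: is_KMS_def)

lemma psi_add: "a \<in> U \<Longrightarrow> b \<in> U \<Longrightarrow> \<psi> (op_add a b) = \<psi> a + \<psi> b"
  using state unfolding is_state_def by metis

lemma psi_scale: "a \<in> U \<Longrightarrow> \<psi> (op_scale c a) = c * \<psi> a"
  using state unfolding is_state_def by metis

text \<open>Elements of the algebra act on functions on all of \<open>pt\<close>, and the identities
  below hold at points of \<open>Xs k\<close> only; a state does not see the difference.\<close>

lemma psi_cong:
  assumes "a \<in> U" "b \<in> U" "\<And>\<xi> x. x \<in> Xs k \<Longrightarrow> a \<xi> x = b \<xi> x"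
  shows "\<psi> a = \<psi> b"
proof -
  have "op_eq \<mu> a b" unfolding op_eq_def by (auto simp: assms(3) space_mu intro!: AE_I2)
  then show ?thesis using state assms(1,2) unfolding is_state_def by metis
qed

lemma psi_sum:
  assumes "finite I" "\<And>i. i \<in> I \<Longrightarrow> a i \<in> U"
  shows "(\<lambda>\<xi> x. \<Sum>i\<in>I. a i \<xi> x) \<in> U \<and> \<psi> (\<lambda>\<xi> x. \<Sum>i\<in>I. a i \<xi> x) = (\<Sum>i\<in>I. \<psi> (a i))"
  using assms
proof (induction I)
  case empty
  have one: "Mop (\<lambda>_. 1) \<in> U" by (intro Mop_in_U continuous_intros)
  \<comment> \<open>The empty sum must be exhibited as an element of the algebra.\<close>
  have "op_scale 0 (Mop (\<lambda>_. 1)) = (\<lambda>\<xi> x. 0)" by (auto simp: op_scale_def)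
  then show ?case using Ualg.scale[OF one, of 0] psi_scale[OF one, of 0] by simp
next
  case (insert j I)
  have "(\<lambda>\<xi> x. \<Sum>i\<in>insert j I. a i \<xi> x) = op_add (a j) (\<lambda>\<xi> x. \<Sum>i\<in>I. a i \<xi> x)"
    using insert by (auto simp: op_add_def)
  then show ?case
    using insert by (simp add: psi_add Ualg.add)
qed

lemma rho_cong:
  assumes "continuous_on (Xs k) f" "\<And>x. x \<in> Xs k \<Longrightarrow> f x = g x"
  shows "\<rho> f = \<rho> g"
proof -
  have "continuous_on (Xs k) g" using assms continuous_on_cong by metis
  then show ?thesis
    unfolding \<rho>_def using assms by (intro psi_cong Mop_in_U) (auto simp: Mop_def)
qed

lemma rho_add:
  assumes "continuous_on (Xs k) f" "continuous_on (Xs k) g"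
  shows "\<rho> (\<lambda>x. f x + g x) = \<rho> f + \<rho> g"
proof -
  have "Mop (\<lambda>x. f x + g x) = op_add (Mop f) (Mop g)"
    by (simp add: Mop_def op_add_def fun_eq_iff distrib_right)
  then show ?thesis
    unfolding \<rho>_def by (simp add: psi_add Mop_in_U assms)
qed

lemma rho_scale:
  assumes "continuous_on (Xs k) f"
  shows "\<rho> (\<lambda>x. c * f x) = c * \<rho> f"
proof -
  have "Mop (\<lambda>x. c * f x) = op_scale c (Mop f)"
    by (simp add: Mop_def op_scale_def fun_eq_iff mult.assoc)
  then show ?thesis
    unfolding \<rho>_def by (simp add: psi_scale Mop_in_U assms)
qed

lemma rho_one: "\<rho> (\<lambda>_. 1) = 1"
  using state by (simp add: \<rho>_def Mop_one is_state_def)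

lemma rho_const: "\<rho> (\<lambda>_. c) = c"
  using rho_scale[of "\<lambda>_. 1" c] by (simp add: rho_one)

text \<open>Multiplication by \<open>f\<close> is the square of the self-adjoint multiplication by
  its root.\<close>

lemma rho_nonneg:
  fixes f :: "pt \<Rightarrow> real"
  assumes f: "continuous_on (Xs k) f" "\<And>x. x \<in> Xs k \<Longrightarrow> f x \<ge> 0"
  shows "Im (\<rho> (\<lambda>x. of_real (f x))) = 0" "Re (\<rho> (\<lambda>x. of_real (f x))) \<ge> 0"
proof -
  let ?s = "\<lambda>x. complex_of_real (sqrt (f x))"
  have s: "continuous_on (Xs k) ?s" by (intro continuous_intros f)
  have "bounded_op \<mu> (Mop ?s)"
    by (intro bounded_linear_op_imp_bounded_op bounded_linear_op_Mop s)
  then have pos: "Im (\<psi> (Mop ?s \<circ> Mop ?s)) = 0 \<and> Re (\<psi> (Mop ?s \<circ> Mop ?s)) \<ge> 0"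
    using state Mop_in_U[OF s] is_adjoint_Mop_real unfolding is_state_def by metis
  have "\<psi> (Mop ?s \<circ> Mop ?s) = \<rho> (\<lambda>x. of_real (f x))"
    unfolding \<rho>_def
  proof (rule psi_cong)
    show "Mop ?s \<circ> Mop ?s \<in> U" by (intro Ualg.comp Mop_in_U s)
    show "Mop (\<lambda>x. complex_of_real (f x)) \<in> U" by (intro Mop_in_U continuous_intros f)
    show "(Mop ?s \<circ> Mop ?s) \<xi> x = Mop (\<lambda>x. complex_of_real (f x)) \<xi> x" if "x \<in> Xs k" for \<xi> x
      using f(2)[OF that] by (simp add: Mop_def mult.assoc[symmetric] of_real_mult[symmetric] del: of_real_mult)
  qed
  with pos show "Im (\<rho> (\<lambda>x. of_real (f x))) = 0" "Re (\<rho> (\<lambda>x. of_real (f x))) \<ge> 0" by auto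
qed

lemma KMS_eq:
  "a \<in> U \<Longrightarrow> b \<in> U \<Longrightarrow> entire_ext \<mu> \<sigma> a F \<Longrightarrow> \<psi> (a \<circ> b) = \<psi> (b \<circ> F (\<i> * complex_of_real \<beta>))"
  using KMS unfolding is_KMS_def by metis

lemma op_eq_sym: "op_eq \<mu> A B \<Longrightarrow> op_eq \<mu> B A"
  unfolding op_eq_def by (simp add: eq_commute)

lemma psi_genop_commute:
  assumes f: "continuous_on (Xs k) f" and g: "continuous_on (Xs k) g"
  shows "\<psi> (genop k p f n g) = \<psi> (genop k p (\<lambda>_. 1) n (\<lambda>x. g x * f x))"
proof -
  have one: "continuous_on (Xs k) (\<lambda>_. 1 :: complex)" by simp
  \<comment> \<open>The case \<open>n = 0\<close> of \<open>sigma_gen\<close>: the flow fixes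
    multiplication operators, so the constant family is their entire extension and KMS reduces to a
    trace property.\<close>
  have "op_eq \<mu> (Mop f) (\<sigma> t (Mop f))" for t
    using op_eq_sym[OF sigma_gen[OF f one, where n = 0 and t = t]] by (simp add: genop_0 Mop_one)
  then have "entire_ext \<mu> \<sigma> (Mop f) (\<lambda>_. Mop f)"
    by (intro entire_ext_const bounded_linear_op_Mop f)
  from KMS_eq[OF Mop_in_U[OF f] genop_in_U[OF one g] this, of n]
  show ?thesis by (simp add: Mop_comp_genop genop_comp_Mop)
qed

text \<open>A fibre of the \<open>n\<close>-th power of the shift meets each cylinder of length \<open>n\<close> in exactly one point, so
  \<open>M\<^sub>g M\<^sub>l = \<Sum>\<^sub>v M(g 1\<^sub>v) e\<^sub>n M(1\<^sub>v)\<close> with \<open>l = lam_inv p n\<close> and \<open>v\<close> ranging over the cylinders.\<close>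
lemma psi_genop:
  assumes g: "continuous_on (Xs k) g"
  shows "\<psi> (genop k p (\<lambda>_. 1) n g) = \<rho> (\<lambda>x. g x * of_real (lam_inv p n x))"
proof -
  define I where "I v x = (if restrict x {..<n} = v then 1 else 0 :: complex)" for v x :: pt
  have I: "continuous_on (Xs k) (I v)" for v
    unfolding I_def by (rule continuous_on_word_indicator)
  have gI: "continuous_on (Xs k) (\<lambda>x. g x * I v x)" for v by (intro continuous_intros g I)
  have one: "continuous_on (Xs k) (\<lambda>_. 1 :: complex)" by simp
  have gl: "continuous_on (Xs k) (\<lambda>x. g x * of_real (lam_inv p n x))"
    by (intro continuous_intros g continuous_on_lam_inv p_cont)
  note sum1 = psi_sum[OF finite_words, where a = "\<lambda>v. genop k p (\<lambda>x. g x * I v x) n (I v)", OF genop_in_U[OF gI I]]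
  note sum2 = psi_sum[OF finite_words, where a = "\<lambda>v. genop k p (\<lambda>_. 1) n (\<lambda>x. I v x * (g x * I v x))",
      OF genop_in_U[OF one continuous_on_mult[OF I gI]]]
  have "\<rho> (\<lambda>x. g x * of_real (lam_inv p n x))
      = \<psi> (\<lambda>\<xi> x. \<Sum>v\<in>words k n. genop k p (\<lambda>x. g x * I v x) n (I v) \<xi> x)"
    unfolding \<rho>_def
  proof (rule psi_cong)
    fix \<xi> x assume x: "x \<in> Xs k"
    let ?r = "restrict x {..<n}"
    \<comment> \<open>The right indicator keeps the single point of the fibre of \<open>x\<close>
      with prefix \<open>v\<close>, and the left one asks \<open>x\<close> to have that prefix. So
      the surviving point is \<open>x\<close> itself.\<close>
    have "genop k p (\<lambda>x. g x * I v x) n (I v) \<xi> x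
        = (if v = ?r then g x * of_real (lam_inv p n x) * \<xi> x else 0)" if v: "v \<in> words k n" for v
    proof -
      have "genop k p (\<lambda>x. g x * I v x) n (I v) \<xi> x
          = (\<Sum>u\<in>words k n. if u = v then of_real (lam_inv p n (cat n v ((shift ^^ n) x))) *
              (g x * I v x) * \<xi> (cat n v ((shift ^^ n) x)) else 0)"
        unfolding genop_words[OF x] by (intro sum.cong refl) (auto simp: I_def)
      also have "\<dots> = of_real (lam_inv p n (cat n v ((shift ^^ n) x))) * (g x * I v x) * \<xi> (cat n v ((shift ^^ n) x))"
        using v by simp
      also have "\<dots> = (if v = ?r then g x * of_real (lam_inv p n x) * \<xi> x else 0)"
        by (auto simp: I_def)
      finally show ?thesis .
    qed
    then show "Mop (\<lambda>x. g x * of_real (lam_inv p n x)) \<xi> x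
        = (\<Sum>v\<in>words k n. genop k p (\<lambda>x. g x * I v x) n (I v) \<xi> x)"
      using restrict_in_words[OF x, of n] by (simp add: Mop_def)
  qed (simp_all add: sum1 Mop_in_U[OF gl])
  also have "\<dots> = (\<Sum>v\<in>words k n. \<psi> (genop k p (\<lambda>x. g x * I v x) n (I v)))"
    by (simp add: sum1)
  \<comment> \<open>Moved to the right, the left indicators meet the right ones; as the cylinders
    partition the space, the sum over \<open>v\<close> restores \<open>g\<close> alone.\<close>
  also have "\<dots> = (\<Sum>v\<in>words k n. \<psi> (genop k p (\<lambda>_. 1) n (\<lambda>x. I v x * (g x * I v x))))"
    by (simp add: psi_genop_commute[OF gI I])
  also have "\<dots> = \<psi> (\<lambda>\<xi> x. \<Sum>v\<in>words k n. genop k p (\<lambda>_. 1) n (\<lambda>x. I v x * (g x * I v x)) \<xi> x)"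
    by (simp add: sum2)
  also have "\<dots> = \<psi> (genop k p (\<lambda>_. 1) n g)"
  proof (rule psi_cong)
    fix \<xi> x assume x: "x \<in> Xs k"
    have inner: "(\<Sum>v\<in>words k n. I v y * (g y * I v y)) = g y" if "y \<in> Xs k" for y
    proof -
      have "(\<Sum>v\<in>words k n. I v y * (g y * I v y)) = (\<Sum>v\<in>words k n. if v = restrict y {..<n} then g y else 0)"
        by (intro sum.cong refl) (auto simp: I_def)
      then show ?thesis using restrict_in_words[OF that, of n] by simp
    qed
    have "(\<Sum>v\<in>words k n. genop k p (\<lambda>_. 1) n (\<lambda>x. I v x * (g x * I v x)) \<xi> x)
        = (\<Sum>u\<in>words k n. of_real (lam_inv p n (cat n u ((shift ^^ n) x))) *
            (1 * (\<Sum>v\<in>words k n. I v (cat n u ((shift ^^ n) x)) * (g (cat n u ((shift ^^ n) x)) * I v (cat n u ((shift ^^ n) x))))) *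
            \<xi> (cat n u ((shift ^^ n) x)))"
      unfolding genop_words[OF x] sum_distrib_left sum_distrib_right by (rule sum.swap)
    also have "\<dots> = genop k p (\<lambda>_. 1) n g \<xi> x"
      unfolding genop_words[OF x]
      by (intro sum.cong refl) (simp add: inner cat_in_Xs shift_in_Xs x)
    finally show "(\<Sum>v\<in>words k n. genop k p (\<lambda>_. 1) n (\<lambda>x. I v x * (g x * I v x)) \<xi> x)
        = genop k p (\<lambda>_. 1) n g \<xi> x" .
  qed (simp_all add: sum2 genop_in_U[OF one g])
  finally show ?thesis by simp
qed

section \<open>The conformality relation for \<open>e_n\<close>\<close>

definition birkhoff_lnH :: "nat \<Rightarrow> pt \<Rightarrow> real" where
  "birkhoff_lnH n x = (\<Sum>j<n. ln (H ((shift ^^ j) x)))"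

lemma birkhoff_lnH_cont: "continuous_on (Xs k) (birkhoff_lnH n)"
proof -
  have "continuous_on (Xs k) (\<lambda>x. ln (H x))"
    using H_cont H_pos by (intro continuous_intros) force+
  then show ?thesis
    unfolding birkhoff_lnH_def by (intro continuous_on_sum continuous_on_compose_shift)
qed

text \<open>For real \<open>t\<close> the factors \<open>H\<close> to the power
  \<open>\<i> * t\<close> collect along the orbit on both sides of \<open>e_n\<close>; on the right
  they are conjugate, which gives the opposite sign in the exponent.\<close>

lemma entire_ext_eop: "entire_ext \<mu> \<sigma> (genop k p (\<lambda>_. 1) n (\<lambda>_. 1)) (flow_e n (birkhoff_lnH n))"
proof (rule entire_ext_flow_e[OF birkhoff_lnH_cont])
  fix t
  have one: "continuous_on (Xs k) (\<lambda>_. 1 :: complex)" by simp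
  define h where "h = (\<lambda>x. exp (\<i> * complex_of_real t * complex_of_real (ln (H x))))"
  have h: "(\<Prod>j<n. h ((shift ^^ j) x)) = exp (\<i> * complex_of_real t * of_real (birkhoff_lnH n x))" for x
    by (simp add: h_def birkhoff_lnH_def exp_sum[symmetric] sum_distrib_left)
  have h': "(\<Prod>j<n. cnj (h ((shift ^^ j) x))) = exp (- \<i> * complex_of_real t * of_real (birkhoff_lnH n x))" for x
    unfolding cnj_prod[symmetric] h by (simp add: exp_cnj)
  have "Mop (\<lambda>_. 1) \<circ> ((Mop h \<circ> Sop) ^^ n) \<circ> ((Sadj k p \<circ> Mop (\<lambda>x. cnj (h x))) ^^ n) \<circ> Mop (\<lambda>_. 1)
      = flow_e n (birkhoff_lnH n) (complex_of_real t)"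
    by (intro ext) (simp add: flow_e_def genop_def eop_def Mop_one Mop_Sop_funpow Sadj_Mop_funpow h h' Sop_funpow, simp add: Mop_def Sop_funpow)
  then show "op_eq \<mu> (flow_e n (birkhoff_lnH n) (complex_of_real t)) (\<sigma> t (genop k p (\<lambda>_. 1) n (\<lambda>_. 1)))"
    using op_eq_sym[OF sigma_gen[OF one one, where n = n and t = t]] by (simp add: h_def)
qed

lemma lam_inv_sum:
  assumes "x \<in> Xs k"
  shows "(\<Sum>v\<in>words k n. lam_inv p n (cat n v x)) = 1"
proof -
  have "(LL k p ^^ n) (\<lambda>_. 1 :: real) x = 1"
    using assms
  proof (induction n arbitrary: x)
    case (Suc n)
    then show ?case by (simp add: LL_words cat_in_Xs p_words)
  qed simp
  then show ?thesis by (simp add: LL_funpow[OF assms])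
qed

text \<open>Functions in the range of \<open>e_n\<close> are constant on fibres. Both idempotence of
  \<open>e_n\<close> and the collapse of \<open>e_n M_h e_n\<close> come from this.\<close>

lemma eop_fibre:
  assumes "x \<in> Xs k" "v \<in> words k n"
  shows "eop k p n \<xi> (cat n v ((shift ^^ n) x)) = eop k p n \<xi> x"
  using assms by (simp add: eop_words cat_in_Xs shift_in_Xs)

lemma rho_conformal:
  assumes f: "continuous_on (Xs k) f"
  defines "w \<equiv> \<lambda>z. exp (- \<beta> * ln (H z))"
  shows "\<rho> f = \<rho> (\<lambda>x. of_real (exp (\<beta> * birkhoff_lnH n x) * lam_inv p n x) * (LL k w ^^ n) f ((shift ^^ n) x))"
proof -
  let ?u = "birkhoff_lnH n"
  have lam_pos: "lam_inv p n x > 0" if "x \<in> Xs k" for x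
    by (rule lam_inv_pos[OF p_pos that])
  have lam_cont: "continuous_on (Xs k) (lam_inv p n)" by (rule continuous_on_lam_inv[OF p_cont])
  \<comment> \<open>The division anticipates the factor that \<open>psi_genop\<close> produces, and
    it cancels the weights of \<open>e_n\<close> later on.\<close>
  define g where "g x = f x / of_real (lam_inv p n x)" for x
  have g: "continuous_on (Xs k) g"
    unfolding g_def using lam_pos by (intro continuous_intros f lam_cont) force
  have one: "continuous_on (Xs k) (\<lambda>_. 1 :: complex)" by simp
  define E where "E = (\<lambda>x. complex_of_real (exp (\<beta> * ?u x)))"
  define E' where "E' = (\<lambda>x. complex_of_real (exp (- \<beta> * ?u x)))"
  have E: "continuous_on (Xs k) E" "continuous_on (Xs k) E'"
    unfolding E_def E'_def by (intro continuous_intros birkhoff_lnH_cont)+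
  have w: "continuous_on (Xs k) w"
    unfolding w_def using H_pos by (intro continuous_intros H_cont) force
  have w_lam: "lam_inv w n x = exp (- \<beta> * ?u x)" for x
    unfolding w_def lam_inv_exp birkhoff_lnH_def by (simp add: sum_distrib_left sum_negf)
  define G where "G x = (LL k w ^^ n) f ((shift ^^ n) x)" for x
  have G: "continuous_on (Xs k) G"
    unfolding G_def by (rule continuous_on_compose_shift[OF continuous_on_LL_funpow[OF w f]])
  \<comment> \<open>At this argument \<open>\<i> * z\<close> is \<open>- \<beta>\<close>, so the
    negative power of \<open>H\<close> stands on the left.\<close>
  have flow: "flow_e n ?u (\<i> * complex_of_real \<beta>) = genop k p E' n E"
    by (simp add: flow_e_def E_def E'_def exp_of_real[symmetric] mult.assoc[symmetric])
  let ?e = "genop k p (\<lambda>_. 1) n (\<lambda>_. 1)" and ?b = "genop k p (\<lambda>_. 1) n g"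
  have "\<rho> f = \<rho> (\<lambda>x. g x * of_real (lam_inv p n x))"
    using lam_pos by (intro rho_cong f) (force simp: g_def)
  also have "\<dots> = \<psi> ?b" by (rule psi_genop[OF g, symmetric])
  \<comment> \<open>Idempotence creates the extra copy of \<open>e_n\<close> to which the KMS
    condition is applied.\<close>
  also have "\<dots> = \<psi> (?e \<circ> ?b)"
  proof (rule psi_cong)
    fix \<xi> x assume x: "x \<in> Xs k"
    have "(?e \<circ> ?b) \<xi> x = (\<Sum>v\<in>words k n. of_real (lam_inv p n (cat n v ((shift ^^ n) x))) * ?b \<xi> x)"
      unfolding comp_apply genop_words[OF x, of _ _ _ "?b \<xi>"]
      by (intro sum.cong refl) (simp add: genop_def Mop_def eop_fibre[OF x])
    also have "\<dots> = of_real (\<Sum>v\<in>words k n. lam_inv p n (cat n v ((shift ^^ n) x))) * ?b \<xi> x"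
      by (simp add: sum_distrib_right)
    finally show "?b \<xi> x = (?e \<circ> ?b) \<xi> x"
      using lam_inv_sum[OF shift_in_Xs[OF x], of n] by simp
  qed (intro Ualg.comp genop_in_U one g)+
  also have "\<dots> = \<psi> (?b \<circ> genop k p E' n E)"
    using KMS_eq[OF genop_in_U[OF one one] genop_in_U[OF one g] entire_ext_eop, of n n]
    unfolding flow .
  also have "\<dots> = \<psi> (genop k p G n E)"
  proof (rule psi_cong)
    fix \<xi> x assume x: "x \<in> Xs k"
    define y where "y v = cat n v ((shift ^^ n) x)" for v
    have y: "y v \<in> Xs k" if "v \<in> words k n" for v
      unfolding y_def by (intro cat_in_Xs that shift_in_Xs x)
    have "(?b \<circ> genop k p E' n E) \<xi> x = (\<Sum>v\<in>words k n. of_real (lam_inv p n (y v)) * (1 * g (y v)) * genop k p E' n E \<xi> (y v))"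
      unfolding comp_apply y_def by (rule genop_words[OF x])
    \<comment> \<open>Three effects meet: \<open>g\<close> cancels the weight of the outer average,
      \<open>E'\<close> is exactly the weight of the \<open>n\<close>-th iterate of
      \<open>LL k w\<close>, and the inner average is constant on the fibre. The remaining sum is
      \<open>G x\<close>.\<close>
    also have "\<dots> = (\<Sum>v\<in>words k n. lam_inv w n (y v) *\<^sub>R f (y v) * eop k p n (Mop E \<xi>) x)"
    proof (intro sum.cong refl)
      fix v assume v: "v \<in> words k n"
      have "of_real (lam_inv p n (y v)) * g (y v) = f (y v)"
        using lam_pos[OF y[OF v]] by (simp add: g_def)
      moreover have "genop k p E' n E \<xi> (y v) = E' (y v) * eop k p n (Mop E \<xi>) x"
        using eop_fibre[OF x v] by (simp add: genop_def Mop_def y_def)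
      ultimately show "of_real (lam_inv p n (y v)) * (1 * g (y v)) * genop k p E' n E \<xi> (y v)
          = lam_inv w n (y v) *\<^sub>R f (y v) * eop k p n (Mop E \<xi>) x"
        by (simp add: w_lam E'_def scaleR_conv_of_real)
    qed
    also have "\<dots> = G x * eop k p n (Mop E \<xi>) x"
      by (simp add: G_def LL_funpow[OF shift_in_Xs[OF x]] y_def sum_distrib_right)
    finally show "(?b \<circ> genop k p E' n E) \<xi> x = genop k p G n E \<xi> x"
      by (simp add: genop_def Mop_def)
  qed (intro Ualg.comp genop_in_U one g G E)+
  also have "\<dots> = \<psi> (genop k p (\<lambda>_. 1) n (\<lambda>x. E x * G x))"
    by (rule psi_genop_commute[OF G E(1)])
  also have "\<dots> = \<rho> (\<lambda>x. E x * G x * of_real (lam_inv p n x))"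
    by (rule psi_genop) (intro continuous_intros E G)
  also have "(\<lambda>x. E x * G x * of_real (lam_inv p n x))
      = (\<lambda>x. of_real (exp (\<beta> * ?u x) * lam_inv p n x) * (LL k w ^^ n) f ((shift ^^ n) x))"
    by (auto simp: E_def G_def)
  finally show ?thesis .
qed

text \<open>Here \<open>f\<close> may change sign. In the conformality relation the factor in front
  of the iterate is positive, so the sign of the iterate alone decides.\<close>

lemma rho_real_nonneg_transfer:
  fixes f :: "pt \<Rightarrow> real"
  assumes f: "continuous_on (Xs k) f"
    and pos: "\<And>x. x \<in> Xs k \<Longrightarrow> (LL k (\<lambda>z. exp (- \<beta> * ln (H z))) ^^ n) f x \<ge> 0"
  shows "Im (\<rho> (\<lambda>x. of_real (f x))) = 0" "Re (\<rho> (\<lambda>x. of_real (f x))) \<ge> 0"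
proof -
  let ?w = "\<lambda>z. exp (- \<beta> * ln (H z))"
  define R where "R x = exp (\<beta> * birkhoff_lnH n x) * lam_inv p n x * (LL k ?w ^^ n) f ((shift ^^ n) x)" for x
  have w: "continuous_on (Xs k) ?w"
    using H_pos by (intro continuous_intros H_cont) force
  have R_cont: "continuous_on (Xs k) R"
    unfolding R_def
    by (intro continuous_intros birkhoff_lnH_cont continuous_on_lam_inv p_cont
        continuous_on_compose_shift[OF continuous_on_LL_funpow[OF w f]])
  have R_pos: "R x \<ge> 0" if "x \<in> Xs k" for x
    unfolding R_def using lam_inv_pos[OF p_pos that] pos[OF shift_in_Xs[OF that]] by (simp add: less_imp_le)
  have "\<rho> (\<lambda>x. of_real (f x)) = \<rho> (\<lambda>x. of_real (exp (\<beta> * birkhoff_lnH n x) * lam_inv p n x) *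
      (LL k ?w ^^ n) (\<lambda>x. of_real (f x)) ((shift ^^ n) x))"
    by (intro rho_conformal continuous_intros f)
  also have "\<dots> = \<rho> (\<lambda>x. of_real (R x))"
    by (rule rho_cong[symmetric], intro continuous_intros R_cont)
       (simp add: R_def LL_funpow shift_in_Xs scaleR_conv_of_real)
  finally show "Im (\<rho> (\<lambda>x. of_real (f x))) = 0" "Re (\<rho> (\<lambda>x. of_real (f x))) \<ge> 0"
    using rho_nonneg[OF R_cont R_pos] by auto
qed

text \<open>Positivity is applied to \<open>f - a\<close> and \<open>b - f\<close>, whose iterates
  are nonnegative by linearity; since \<rho> maps 1 to 1, the constants come out as they
  are.\<close>

lemma rho_bounds:
  fixes f :: "pt \<Rightarrow> real"
  assumes f: "continuous_on (Xs k) f"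
  defines "w \<equiv> \<lambda>z. exp (- \<beta> * ln (H z))"
  assumes ab: "\<And>x. x \<in> Xs k \<Longrightarrow> a * (LL k w ^^ n) (\<lambda>_. 1) x \<le> (LL k w ^^ n) f x"
      "\<And>x. x \<in> Xs k \<Longrightarrow> (LL k w ^^ n) f x \<le> b * (LL k w ^^ n) (\<lambda>_. 1) x"
  shows "a \<le> Re (\<rho> (\<lambda>x. of_real (f x)))" "Re (\<rho> (\<lambda>x. of_real (f x))) \<le> b"
    "Im (\<rho> (\<lambda>x. of_real (f x))) = 0"
proof -
  have cf: "continuous_on (Xs k) (\<lambda>x. complex_of_real (f x))" by (intro continuous_intros f)
  have one: "continuous_on (Xs k) (\<lambda>_. 1 :: complex)" by simp
  have aff: "\<rho> (\<lambda>x. of_real (c * 1 + d * f x)) = of_real c + of_real d * \<rho> (\<lambda>x. of_real (f x))" for c d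
    using rho_add[OF continuous_on_mult[OF continuous_on_const one] continuous_on_mult[OF continuous_on_const cf], of "of_real c" "of_real d"]
    by (simp add: rho_scale[OF cf] rho_const)
  have LLaff: "(LL k w ^^ n) (\<lambda>x. c * 1 + d * f x) x = c * (LL k w ^^ n) (\<lambda>_. 1) x + d * (LL k w ^^ n) f x"
    if "x \<in> Xs k" for c d x
    by (simp add: LL_funpow[OF that] sum.distrib sum_distrib_left algebra_simps)
  have caff: "continuous_on (Xs k) (\<lambda>x. c * 1 + d * f x)" for c d by (intro continuous_intros f)
  have "Re (\<rho> (\<lambda>x. of_real (- a * 1 + 1 * f x))) \<ge> 0" "Im (\<rho> (\<lambda>x. of_real (- a * 1 + 1 * f x))) = 0"
    using ab(1) LLaff[of _ "-a" 1] unfolding w_def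
    by (intro rho_real_nonneg_transfer[where n = n] caff; simp)+
  then show "a \<le> Re (\<rho> (\<lambda>x. of_real (f x)))" "Im (\<rho> (\<lambda>x. of_real (f x))) = 0"
    unfolding aff by auto
  have "Re (\<rho> (\<lambda>x. of_real (b * 1 + - 1 * f x))) \<ge> 0"
    using ab(2) LLaff[of _ b "-1"] unfolding w_def
    by (intro rho_real_nonneg_transfer[where n = n] caff) simp
  then show "Re (\<rho> (\<lambda>x. of_real (f x))) \<le> b" unfolding aff by auto
qed

section \<open>Identification of \<rho> with the eigenprobability\<close>

context
  fixes \<nu> :: "pt measure" and lam :: real
  assumes nu: "prob_space \<nu>" "sets \<nu> = sets (borelX k)"
    and eig: "\<And>f::pt \<Rightarrow> real. continuous_on (Xs k) f \<Longrightarrow>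
      integral\<^sup>L \<nu> (LL k (\<lambda>z. exp (- \<beta> * ln (H z))) f) = lam * integral\<^sup>L \<nu> f"
    and H_holder: "cyl_holder k H"
begin

lemma rho_eq_integral_real:
  fixes f :: "pt \<Rightarrow> real"
  assumes f: "continuous_on (Xs k) f"
  shows "\<rho> (\<lambda>x. of_real (f x)) = of_real (\<integral>x. f x \<partial>\<nu>)"
proof -
  define w where "w = (\<lambda>z. exp (- \<beta> * ln (H z)))"
  have A: "cyl_holder k (\<lambda>z. - \<beta> * ln (H z))"
    by (rule cyl_holder_ln[OF H_holder H_pos])
  have w: "continuous_on (Xs k) w"
    unfolding w_def by (intro continuous_intros cyl_holder_continuous_on A)
  have "\<bar>Re (\<rho> (\<lambda>x. of_real (f x))) - (\<integral>x. f x \<partial>\<nu>)\<bar> \<le> \<delta> \<and> Im (\<rho> (\<lambda>x. of_real (f x))) = 0"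
    if \<delta>: "\<delta> > 0" for \<delta>
  proof (rule LL_ratio_oscillation[OF A f Xs_nonempty \<delta>])
    fix n a b
    assume ba: "b - a \<le> \<delta>"
      and ab: "\<And>x. x \<in> Xs k \<Longrightarrow> a * (LL k (\<lambda>z. exp (- \<beta> * ln (H z))) ^^ n) (\<lambda>_. 1) x \<le> (LL k (\<lambda>z. exp (- \<beta> * ln (H z))) ^^ n) f x"
      "\<And>x. x \<in> Xs k \<Longrightarrow> (LL k (\<lambda>z. exp (- \<beta> * ln (H z))) ^^ n) f x \<le> b * (LL k (\<lambda>z. exp (- \<beta> * ln (H z))) ^^ n) (\<lambda>_. 1) x"
    have "a \<le> (\<integral>x. f x \<partial>\<nu>)" "(\<integral>x. f x \<partial>\<nu>) \<le> b"
      using eigenmeasure_bounds[OF nu eig w[unfolded w_def] _ f ab] by simp_all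
    with rho_bounds[OF f ab] ba show ?thesis by auto
  qed
  note close = this
  \<comment> \<open>The distance is at most every positive \<delta>; were it positive, its half
    would be a contradiction.\<close>
  have "Re (\<rho> (\<lambda>x. of_real (f x))) = (\<integral>x. f x \<partial>\<nu>)"
  proof (rule ccontr)
    assume "\<not> ?thesis"
    then show False
      using close[of "\<bar>Re (\<rho> (\<lambda>x. of_real (f x))) - (\<integral>x. f x \<partial>\<nu>)\<bar> / 2"] by auto
  qed
  moreover have "Im (\<rho> (\<lambda>x. of_real (f x))) = 0" using close[of 1] by simp
  ultimately show ?thesis by (simp add: complex_eq_iff)
qed

lemma rho_eq_integral:
  fixes f :: "pt \<Rightarrow> complex"
  assumes f: "continuous_on (Xs k) f"
  shows "\<rho> f = (\<integral>x. f x \<partial>\<nu>)"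
proof -
  have R: "continuous_on (Xs k) (\<lambda>x. Re (f x))" and I: "continuous_on (Xs k) (\<lambda>x. Im (f x))"
    by (intro continuous_intros f)+
  have cR: "continuous_on (Xs k) (\<lambda>x. complex_of_real (Re (f x)))"
    and cI: "continuous_on (Xs k) (\<lambda>x. complex_of_real (Im (f x)))"
    by (intro continuous_intros f)+
  have "\<rho> f = \<rho> (\<lambda>x. of_real (Re (f x)) + \<i> * of_real (Im (f x)))"
    by (simp add: complex_eq[symmetric])
  also have "\<dots> = of_real (\<integral>x. Re (f x) \<partial>\<nu>) + \<i> * of_real (\<integral>x. Im (f x) \<partial>\<nu>)"
    by (subst rho_add[OF cR continuous_on_mult[OF continuous_on_const cI]])
       (simp add: rho_scale[OF cI] rho_eq_integral_real[OF R] rho_eq_integral_real[OF I])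
  also have "\<dots> = (\<integral>x. f x \<partial>\<nu>)"
    using integrable_continuous_Xs[OF nu f] by (simp add: complex_eq_iff)
  finally show ?thesis .
qed

lemma psi_genop_eq_integral:
  assumes f: "continuous_on (Xs k) f" and g: "continuous_on (Xs k) g"
  shows "\<psi> (genop k p f n g) = (\<integral>x. f x * complex_of_real (lam_inv p n x) * g x \<partial>\<nu>)"
proof -
  have "\<psi> (genop k p f n g) = \<rho> (\<lambda>x. g x * f x * of_real (lam_inv p n x))"
    unfolding psi_genop_commute[OF f g] by (rule psi_genop) (intro continuous_intros f g)
  also have "\<dots> = (\<integral>x. g x * f x * of_real (lam_inv p n x) \<partial>\<nu>)"
    by (rule rho_eq_integral) (intro continuous_intros f g continuous_on_lam_inv p_cont)
  finally show ?thesis by (simp add: mult_ac)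
qed

end

end

theorem theorem2p3:
  fixes k :: nat and p H :: "pt \<Rightarrow> real" and \<beta> lam :: real
    and \<mu> \<nu> :: "pt measure" and \<sigma> :: "real \<Rightarrow> op \<Rightarrow> op" and \<psi> :: "op \<Rightarrow> complex"
  assumes p_pos: "\<forall>x\<in>Xs k. p x > 0"
    and p_holder: "holderX k p"
    and p_norm: "\<forall>x\<in>Xs k. (\<Sum>z\<in>{z\<in>Xs k. shift z = x}. p z) = 1"
    and mu_prob: "prob_space \<mu>" and mu_sets: "sets \<mu> = sets (borelX k)"
    and mu_inv: "\<forall>f::pt \<Rightarrow> complex. contX k f \<longrightarrow>
                   integral\<^sup>L \<mu> (LL k p f) = integral\<^sup>L \<mu> f"
    and H_pos: "\<forall>x\<in>Xs k. H x > 0"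
    and H_holder: "holderX k H"
    and lam: "largest_eigenvalue k (\<lambda>z. exp (- \<beta> * ln (H z))) lam"
    and nu_prob: "prob_space \<nu>" and nu_sets: "sets \<nu> = sets (borelX k)"
    and nu_eig: "\<forall>f::pt \<Rightarrow> real. contX k f \<longrightarrow>
                   integral\<^sup>L \<nu> (LL k (\<lambda>z. exp (- \<beta> * ln (H z))) f) = lam * integral\<^sup>L \<nu> f"
    and sigma_hom: "\<forall>t. star_hom \<mu> (Ualg k p \<mu>) (\<sigma> t)"
    and sigma_gen: "\<forall>t f g n. contX k f \<longrightarrow> contX k g \<longrightarrow>
          op_eq \<mu> (\<sigma> t (genop k p f n g))
            (Mop f \<circ> ((Mop (\<lambda>x. exp (\<i> * complex_of_real t * complex_of_real (ln (H x)))) \<circ> Sop) ^^ n)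
                   \<circ> ((Sadj k p \<circ> Mop (\<lambda>x. cnj (exp (\<i> * complex_of_real t * complex_of_real (ln (H x)))))) ^^ n)
                   \<circ> Mop g)"
    and KMS: "is_KMS \<mu> (Ualg k p \<mu>) \<sigma> \<beta> \<psi>"
  shows "\<forall>f g n. contX k f \<longrightarrow> contX k g \<longrightarrow>
           \<psi> (genop k p f n g) = (\<integral>x. f x * complex_of_real (lam_inv p n x) * g x \<partial>\<nu>)"
proof -
  have H: "cyl_holder k H" by (rule holderX_imp_cyl_holder[OF H_holder])
  interpret mu: prob_space \<mu> by (rule mu_prob)
  interpret kms_gibbs_shift \<mu> k p H \<beta> \<sigma> \<psi>
  proof
    show "continuous_on (Xs k) p"
      by (rule cyl_holder_continuous_on[OF holderX_imp_cyl_holder[OF p_holder]])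
    show "continuous_on (Xs k) H" by (rule cyl_holder_continuous_on[OF H])
  qed (use p_pos p_norm mu_sets mu_inv H_pos sigma_gen KMS in \<open>simp_all add: contX_iff_continuous_on\<close>)
  show ?thesis
    using psi_genop_eq_integral[OF nu_prob nu_sets _ H, of lam] nu_eig
    by (simp add: contX_iff_continuous_on)
qed

end
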